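(* Let $B\wr\mathcal{H}(d)$ be a quantum wreath product as in the context, and suppose $B$ has an algebra automorphism $b\mapsto b^\#$; extend it factorwise to $B^{\otimes k}$. Let $A$ be the free associative $K$-algebra generated by $B^{\otimes d}$ and symbols $H_1,\dots,H_{d-1}$, and let $\#:A\to B\wr\mathcal{H}(d)$ be the algebra homomorphism with $b_1\otimes\cdots\otimes b_d\mapsto b_1^\#\otimes\cdots\otimes b_d^\#$ and $H_i\mapsto -H_i+S_i$. Then $\#$ induces an algebra homomorphism $B\wr\mathcal{H}(d)\to B\wr\mathcal{H}(d)$ if and only if (1) $\sigma(R)=R^\#$ and $\sigma(S)=S^\#$; (2) for all $b\in B\otimes B$: $\sigma(b^\#)=\sigma(b)^\#$ and $S\,b^\#-\sigma(b^\#)\,S=\rho(b^\#)+\rho(b)^\#$; (3) if $d\ge3$, for all $i,j$ with $|i-j|=1$: $S_iS_jS_i+\sigma_i(S_j)R_i=S_jS_iS_j+\sigma_j(S_i)R_j$. In this case $\#$ is an automorphism of $B\wr\mathcal{H}(d)$.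
   Context: Let $K$ be a commutative ring and $B$ a unital associative $K$-algebra, free over $K$; tensor products over $K$. Fix $d\ge2$, $S,R\in B\otimes B$ and $K$-linear maps $\sigma,\rho:B\otimes B\to B\otimes B$. For $Z\in B\otimes B$, $Z_i:=1^{\otimes(i-1)}\otimes Z\otimes1^{\otimes(d-i-1)}\in B^{\otimes d}$; for $\phi\in\mathrm{End}_K(B\otimes B)$, $\phi_i$ is $\phi$ applied to tensor factors $i,i+1$ of $B^{\otimes d}$. The quantum wreath product $B\wr\mathcal{H}(d)$ is the unital $K$-algebra generated by the algebra $B^{\otimes d}$ and $H_1,\dots,H_{d-1}$ subject to $H_kH_{k+1}H_k=H_{k+1}H_kH_{k+1}$, $H_iH_j=H_jH_i$ ($|i-j|\ge2$), $H_i^2=S_iH_i+R_i$, $H_ib=\sigma_i(b)H_i+\rho_i(b)$ ($b\in B^{\otimes d}$). With $H_w$ defined via reduced expressions of $w\in\Sigma_d$, it is assumed that $B\wr\mathcal{H}(d)$ has a PBW basis $\{(b_{j_1}\otimes\cdots\otimes b_{j_d})H_w\}$ for a $K$-basis $\{b_j\}$ of $B$. *)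

theory Defs
  imports Main "HOL-Combinatorics.Permutations"
begin

definition Kalg :: "('k::comm_ring_1 \<Rightarrow> 'a::ring_1 \<Rightarrow> 'a) \<Rightarrow> bool" where
  "Kalg sm \<longleftrightarrow>
     (\<forall>a x y. sm a (x + y) = sm a x + sm a y) \<and>
     (\<forall>a b x. sm (a + b) x = sm a x + sm b x) \<and>
     (\<forall>a b x. sm (a * b) x = sm a (sm b x)) \<and>
     (\<forall>x. sm 1 x = x) \<and>
     (\<forall>a x y. sm a (x * y) = sm a x * y) \<and>
     (\<forall>a x y. sm a (x * y) = x * sm a y)"

definition Klin :: "('k \<Rightarrow> 'a::ab_group_add \<Rightarrow> 'a) \<Rightarrow> ('k \<Rightarrow> 'c::ab_group_add \<Rightarrow> 'c)
                      \<Rightarrow> ('a \<Rightarrow> 'c) \<Rightarrow> bool" where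
  "Klin sm1 sm2 f \<longleftrightarrow> (\<forall>x y. f (x + y) = f x + f y) \<and> (\<forall>a x. f (sm1 a x) = sm2 a (f x))"

definition Kalg_hom :: "('k \<Rightarrow> 'a::ring_1 \<Rightarrow> 'a) \<Rightarrow> ('k \<Rightarrow> 'c::ring_1 \<Rightarrow> 'c)
                      \<Rightarrow> ('a \<Rightarrow> 'c) \<Rightarrow> bool" where
  "Kalg_hom sm1 sm2 f \<longleftrightarrow> Klin sm1 sm2 f \<and> (\<forall>x y. f (x * y) = f x * f y) \<and> f 1 = 1"

definition is_basis_on :: "('k::comm_ring_1 \<Rightarrow> 'm::ab_group_add \<Rightarrow> 'm) \<Rightarrow> 'i set \<Rightarrow> ('i \<Rightarrow> 'm) \<Rightarrow> bool" where
  "is_basis_on sm I v \<longleftrightarrow>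
     (\<forall>x. \<exists>!c. (\<forall>i. i \<notin> I \<longrightarrow> c i = 0) \<and> finite {i. c i \<noteq> 0} \<and>
              x = (\<Sum>i\<in>{i. c i \<noteq> 0}. sm (c i) (v i)))"

text \<open>B (with scalar action smB) is free with basis e; tp2 : B x B -> T2 realises
  T2 = B (x) B: tp2 is bilinear, multiplicative on pure tensors, unital, and the
  e j (x) e l form a K-basis.\<close>
definition is_tensor2 ::
  "('k::comm_ring_1 \<Rightarrow> 'b::ring_1 \<Rightarrow> 'b) \<Rightarrow> ('j \<Rightarrow> 'b) \<Rightarrow> ('k \<Rightarrow> 'b2::ring_1 \<Rightarrow> 'b2)
   \<Rightarrow> ('b \<Rightarrow> 'b \<Rightarrow> 'b2) \<Rightarrow> bool" where
  "is_tensor2 smB e sm2 tp2 \<longleftrightarrow>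
     Kalg sm2 \<and>
     (\<forall>x x' y. tp2 (x + x') y = tp2 x y + tp2 x' y) \<and>
     (\<forall>x y y'. tp2 x (y + y') = tp2 x y + tp2 x y') \<and>
     (\<forall>a x y. tp2 (smB a x) y = sm2 a (tp2 x y)) \<and>
     (\<forall>a x y. tp2 x (smB a y) = sm2 a (tp2 x y)) \<and>
     (\<forall>x y x' y'. tp2 x y * tp2 x' y' = tp2 (x * x') (y * y')) \<and>
     tp2 1 1 = 1 \<and>
     is_basis_on sm2 UNIV (\<lambda>(j, l). tp2 (e j) (e l))"

text \<open>tpd [x1,...,xd] = x1 (x) ... (x) xd in Td = B^(x)d (only lists of length d matter).\<close>
definition is_tensorpow ::
  "('k::comm_ring_1 \<Rightarrow> 'b::ring_1 \<Rightarrow> 'b) \<Rightarrow> ('j \<Rightarrow> 'b) \<Rightarrow> nat \<Rightarrow> ('k \<Rightarrow> 'bd::ring_1 \<Rightarrow> 'bd)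
   \<Rightarrow> ('b list \<Rightarrow> 'bd) \<Rightarrow> bool" where
  "is_tensorpow smB e d smd tpd \<longleftrightarrow>
     Kalg smd \<and>
     (\<forall>xs ys x y. length xs + length ys + 1 = d \<longrightarrow>
        tpd (xs @ [x + y] @ ys) = tpd (xs @ [x] @ ys) + tpd (xs @ [y] @ ys)) \<and>
     (\<forall>xs ys a x. length xs + length ys + 1 = d \<longrightarrow>
        tpd (xs @ [smB a x] @ ys) = smd a (tpd (xs @ [x] @ ys))) \<and>
     (\<forall>xs ys. length xs = d \<and> length ys = d \<longrightarrow>
        tpd xs * tpd ys = tpd (map2 (*) xs ys)) \<and>
     tpd (replicate d 1) = 1 \<and>
     is_basis_on smd {us. length us = d} (\<lambda>us. tpd (map e us))"

definition ins ::
  "('k::comm_ring_1 \<Rightarrow> 'b2::ring_1 \<Rightarrow> 'b2) \<Rightarrow> ('b::ring_1 \<Rightarrow> 'b \<Rightarrow> 'b2) \<Rightarrow> ('k \<Rightarrow> 'bd::ring_1 \<Rightarrow> 'bd)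
   \<Rightarrow> ('b list \<Rightarrow> 'bd) \<Rightarrow> 'b list \<Rightarrow> 'b list \<Rightarrow> 'b2 \<Rightarrow> 'bd" where
  "ins sm2 tp2 smd tpd xs ys =
     (THE L. Klin sm2 smd L \<and> (\<forall>x y. L (tp2 x y) = tpd (xs @ [x, y] @ ys)))"

definition embi ::
  "('k::comm_ring_1 \<Rightarrow> 'b2::ring_1 \<Rightarrow> 'b2) \<Rightarrow> ('b::ring_1 \<Rightarrow> 'b \<Rightarrow> 'b2) \<Rightarrow> ('k \<Rightarrow> 'bd::ring_1 \<Rightarrow> 'bd)
   \<Rightarrow> ('b list \<Rightarrow> 'bd) \<Rightarrow> nat \<Rightarrow> nat \<Rightarrow> 'b2 \<Rightarrow> 'bd" where
  "embi sm2 tp2 smd tpd d i Z =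
     ins sm2 tp2 smd tpd (replicate (i - 1) 1) (replicate (d - i - 1) 1) Z"

definition opi ::
  "('k::comm_ring_1 \<Rightarrow> 'b2::ring_1 \<Rightarrow> 'b2) \<Rightarrow> ('b::ring_1 \<Rightarrow> 'b \<Rightarrow> 'b2) \<Rightarrow> ('k \<Rightarrow> 'bd::ring_1 \<Rightarrow> 'bd)
   \<Rightarrow> ('b list \<Rightarrow> 'bd) \<Rightarrow> nat \<Rightarrow> ('b2 \<Rightarrow> 'b2) \<Rightarrow> nat \<Rightarrow> 'bd \<Rightarrow> 'bd" where
  "opi sm2 tp2 smd tpd d phi i =
     (THE F. Klin smd smd F \<and>
        (\<forall>xs ys x y. length xs = i - 1 \<and> length ys = d - i - 1 \<longrightarrow>
           F (tpd (xs @ [x, y] @ ys)) = ins sm2 tp2 smd tpd xs ys (phi (tp2 x y))))"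

definition hash2 ::
  "('k::comm_ring_1 \<Rightarrow> 'b2::ring_1 \<Rightarrow> 'b2) \<Rightarrow> ('b::ring_1 \<Rightarrow> 'b \<Rightarrow> 'b2) \<Rightarrow> ('b \<Rightarrow> 'b) \<Rightarrow> 'b2 \<Rightarrow> 'b2" where
  "hash2 sm2 tp2 h = (THE F. Klin sm2 sm2 F \<and> (\<forall>x y. F (tp2 x y) = tp2 (h x) (h y)))"

definition hashd ::
  "('k::comm_ring_1 \<Rightarrow> 'bd::ring_1 \<Rightarrow> 'bd) \<Rightarrow> ('b::ring_1 list \<Rightarrow> 'bd) \<Rightarrow> nat \<Rightarrow> ('b \<Rightarrow> 'b) \<Rightarrow> 'bd \<Rightarrow> 'bd" where
  "hashd smd tpd d h = (THE F. Klin smd smd F \<and> (\<forall>xs. length xs = d \<longrightarrow> F (tpd xs) = tpd (map h xs)))"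

fun word_perm :: "nat list \<Rightarrow> nat \<Rightarrow> nat" where
  "word_perm [] = id"
| "word_perm (i # is) = transpose i (Suc i) \<circ> word_perm is"

definition reduced_word :: "nat \<Rightarrow> (nat \<Rightarrow> nat) \<Rightarrow> nat list \<Rightarrow> bool" where
  "reduced_word d w is \<longleftrightarrow>
     set is \<subseteq> {1..<d} \<and> word_perm is = w \<and>
     (\<forall>js. set js \<subseteq> {1..<d} \<and> word_perm js = w \<longrightarrow> length is \<le> length js)"

fun Hprod :: "(nat \<Rightarrow> 'w::monoid_mult) \<Rightarrow> nat list \<Rightarrow> 'w" where
  "Hprod H [] = 1"
| "Hprod H (i # is) = H i * Hprod H is"

definition Hw :: "nat \<Rightarrow> (nat \<Rightarrow> 'w::monoid_mult) \<Rightarrow> (nat \<Rightarrow> nat) \<Rightarrow> 'w" where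
  "Hw d H w = Hprod H (SOME is. reduced_word d w is)"

definition qw_relations ::
  "('k::comm_ring_1 \<Rightarrow> 'b2::ring_1 \<Rightarrow> 'b2) \<Rightarrow> ('b::ring_1 \<Rightarrow> 'b \<Rightarrow> 'b2) \<Rightarrow> ('k \<Rightarrow> 'bd::ring_1 \<Rightarrow> 'bd)
   \<Rightarrow> ('b list \<Rightarrow> 'bd) \<Rightarrow> nat \<Rightarrow> 'b2 \<Rightarrow> 'b2 \<Rightarrow> ('b2 \<Rightarrow> 'b2) \<Rightarrow> ('b2 \<Rightarrow> 'b2)
   \<Rightarrow> ('bd \<Rightarrow> 'w::ring_1) \<Rightarrow> (nat \<Rightarrow> 'w) \<Rightarrow> bool" where
  "qw_relations sm2 tp2 smd tpd d S R \<sigma> \<rho> g h \<longleftrightarrow>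
     (\<forall>k. 1 \<le> k \<and> k + 1 \<le> d - 1 \<longrightarrow> h k * h (k + 1) * h k = h (k + 1) * h k * h (k + 1)) \<and>
     (\<forall>i j. i \<in> {1..d-1} \<and> j \<in> {1..d-1} \<and> (i + 2 \<le> j \<or> j + 2 \<le> i) \<longrightarrow> h i * h j = h j * h i) \<and>
     (\<forall>i \<in> {1..d-1}. h i * h i = g (embi sm2 tp2 smd tpd d i S) * h i + g (embi sm2 tp2 smd tpd d i R)) \<and>
     (\<forall>i \<in> {1..d-1}. \<forall>b. h i * g b =
          g (opi sm2 tp2 smd tpd d \<sigma> i b) * h i + g (opi sm2 tp2 smd tpd d \<rho> i b))"

definition is_qwreath ::
  "('k::comm_ring_1 \<Rightarrow> 'b::ring_1 \<Rightarrow> 'b) \<Rightarrow> ('j \<Rightarrow> 'b) \<Rightarrow> ('k \<Rightarrow> 'b2::ring_1 \<Rightarrow> 'b2) \<Rightarrow> ('b \<Rightarrow> 'b \<Rightarrow> 'b2)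
   \<Rightarrow> ('k \<Rightarrow> 'bd::ring_1 \<Rightarrow> 'bd) \<Rightarrow> ('b list \<Rightarrow> 'bd) \<Rightarrow> nat
   \<Rightarrow> 'b2 \<Rightarrow> 'b2 \<Rightarrow> ('b2 \<Rightarrow> 'b2) \<Rightarrow> ('b2 \<Rightarrow> 'b2)
   \<Rightarrow> ('k \<Rightarrow> 'w::ring_1 \<Rightarrow> 'w) \<Rightarrow> ('bd \<Rightarrow> 'w) \<Rightarrow> (nat \<Rightarrow> 'w) \<Rightarrow> bool" where
  "is_qwreath smB e sm2 tp2 smd tpd d S R \<sigma> \<rho> smW \<iota> H \<longleftrightarrow>
     Kalg smW \<and> Kalg_hom smd smW \<iota> \<and>
     qw_relations sm2 tp2 smd tpd d S R \<sigma> \<rho> \<iota> H \<and>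
     (\<forall>g h. Kalg_hom smd smW g \<and> qw_relations sm2 tp2 smd tpd d S R \<sigma> \<rho> g h \<longrightarrow>
        (\<exists>f. Kalg_hom smW smW f \<and> (\<forall>b. f (\<iota> b) = g b) \<and> (\<forall>i \<in> {1..d-1}. f (H i) = h i))) \<and>
     is_basis_on smW {(us, w). length us = d \<and> w permutes {1..d}}
        (\<lambda>(us, w). \<iota> (tpd (map e us)) * Hw d H w)"

text \<open>f : W -> W is a K-algebra hom induced by #, i.e. f o pi = # on the generators:
  iota(b) |-> iota(b#), H_i |-> -H_i + S_i.\<close>
definition hash_induced ::
  "('k::comm_ring_1 \<Rightarrow> 'b2::ring_1 \<Rightarrow> 'b2) \<Rightarrow> ('b::ring_1 \<Rightarrow> 'b \<Rightarrow> 'b2) \<Rightarrow> ('k \<Rightarrow> 'bd::ring_1 \<Rightarrow> 'bd)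
   \<Rightarrow> ('b list \<Rightarrow> 'bd) \<Rightarrow> nat \<Rightarrow> 'b2 \<Rightarrow> ('k \<Rightarrow> 'w::ring_1 \<Rightarrow> 'w) \<Rightarrow> ('bd \<Rightarrow> 'w) \<Rightarrow> (nat \<Rightarrow> 'w)
   \<Rightarrow> ('b \<Rightarrow> 'b) \<Rightarrow> ('w \<Rightarrow> 'w) \<Rightarrow> bool" where
  "hash_induced sm2 tp2 smd tpd d S smW \<iota> H hsh f \<longleftrightarrow>
     Kalg_hom smW smW f \<and>
     (\<forall>b. f (\<iota> b) = \<iota> (hashd smd tpd d hsh b)) \<and>
     (\<forall>i \<in> {1..d-1}. f (H i) = - H i + \<iota> (embi sm2 tp2 smd tpd d i S))"

definition hash_conds ::
  "('k::comm_ring_1 \<Rightarrow> 'b2::ring_1 \<Rightarrow> 'b2) \<Rightarrow> ('b::ring_1 \<Rightarrow> 'b \<Rightarrow> 'b2) \<Rightarrow> ('k \<Rightarrow> 'bd::ring_1 \<Rightarrow> 'bd)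
   \<Rightarrow> ('b list \<Rightarrow> 'bd) \<Rightarrow> nat \<Rightarrow> 'b2 \<Rightarrow> 'b2 \<Rightarrow> ('b2 \<Rightarrow> 'b2) \<Rightarrow> ('b2 \<Rightarrow> 'b2)
   \<Rightarrow> ('b \<Rightarrow> 'b) \<Rightarrow> bool" where
  "hash_conds sm2 tp2 smd tpd d S R \<sigma> \<rho> hsh \<longleftrightarrow>
     (let h2 = hash2 sm2 tp2 hsh; Si = (\<lambda>i. embi sm2 tp2 smd tpd d i S);
          Ri = (\<lambda>i. embi sm2 tp2 smd tpd d i R); \<sigma>i = opi sm2 tp2 smd tpd d \<sigma> in
      (\<sigma> R = h2 R \<and> \<sigma> S = h2 S) \<and>
      (\<forall>b. \<sigma> (h2 b) = h2 (\<sigma> b) \<and> S * h2 b - \<sigma> (h2 b) * S = \<rho> (h2 b) + h2 (\<rho> b)) \<and>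
      (d \<ge> 3 \<longrightarrow> (\<forall>i \<in> {1..d-1}. \<forall>j \<in> {1..d-1}. (i = j + 1 \<or> j = i + 1) \<longrightarrow>
          Si i * Si j * Si i + \<sigma>i i (Si j) * Ri i = Si j * Si i * Si j + \<sigma>i j (Si i) * Ri j)))"

end

theory Submission
  imports Defs "HOL.Modules"
begin

text \<open>Write $G_i = S_i - H_i$ for the image of $H_i$. Since the elements $H_w$ are independent over
  $B^{\otimes d}$, comparing coefficients turns the quadratic and the wreath relation for $G_i$ into
  conditions (1) and (2); they only need to be tested for $i = 1$. The braid defect
  $D = G_i G_j G_i - G_j G_i G_j$ then has the form $a + b H_i + c H_j$, and associativity of the
  algebra gives $D G_i = (S_j^\# - G_j) D$. Comparing coefficients shows $\sigma_j(b) = -c$ and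
  $\sigma_i(c) = -b$, while the coefficient identities hidden in the braid relation give
  $\sigma_i(\sigma_j(b)) = 0$; hence $b = c = 0$ and then $a = 0$. So the braid relation for the $G_i$ is
  automatic, and spelling out $a = 0$ yields (3), which is thus a consequence of (1) and (2).
  The inverse sends $H_i$ to $p_i - H_i$ with $p_i^\# = S_i$.\<close>

section \<open>Coefficient identities for one and two generators\<close>

text \<open>The universal property yields an endomorphism only once every relation holds for the
  images, so the braid relation for the G_i must be found without a map that transports it. What is
  available is one-sided: moving the coefficients of the quadratic relation for G_i leftwards
  through G_i G_j turns it into the relation for G_j, because the braid relation of the H_i forces
  \<sigma>_i \<sigma>_j (S_i) = S_j, likewise for R, and makes the other coefficients vanish.
  Comparison with G_j G_j G_i G_j, which has the same tail, is the source of the identity for D. The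
  equation \<sigma>_i \<sigma>_j (S_i) = S_j also removes the length-two terms of D. Since \<sigma>
  is not known to be injective, \<sigma>_i \<sigma>_j (b) = 0 alone says nothing about b; the
  identity for D is what leads from the iterated image back to b. For the inverse the situation is
  easier: the endomorphism exists by then, sends p_i - H_i to H_i and is injective on the left span
  of 1, H_i, H_j, so the braid relation for the p_i - H_i can be pulled back.\<close>

locale ring_emb =
  fixes \<iota> :: "'t::ring_1 \<Rightarrow> 'w::ring_1"
  assumes \<iota>_add: "\<iota> (a + b) = \<iota> a + \<iota> b"
    and \<iota>_mult: "\<iota> (a * b) = \<iota> a * \<iota> b"
    and \<iota>_one: "\<iota> 1 = 1"
begin

lemma \<iota>_zero: "\<iota> 0 = 0"
  using \<iota>_add[of 0 0] by simp

lemma \<iota>_minus: "\<iota> (- a) = - \<iota> a"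
  using \<iota>_add[of a "- a"] by (simp add: \<iota>_zero add_eq_0_iff)

lemma \<iota>_diff: "\<iota> (a - b) = \<iota> a - \<iota> b"
  using \<iota>_add[of a "- b"] by (simp add: \<iota>_minus)

lemmas \<iota>_simps = \<iota>_add \<iota>_mult \<iota>_one \<iota>_zero \<iota>_minus \<iota>_diff

end

section \<open>One generator over an abstract coefficient ring\<close>

locale hecke_gen = ring_emb \<iota> for \<iota> :: "'t::ring_1 \<Rightarrow> 'w::ring_1" +
  fixes S R :: 't and s r :: "'t \<Rightarrow> 't" and H :: 'w
  assumes quad: "H * H = \<iota> S * H + \<iota> R"
    and wreath: "H * \<iota> b = \<iota> (s b) * H + \<iota> (r b)"
    and indep: "\<iota> a + \<iota> b * H = 0 \<Longrightarrow> a = 0 \<and> b = 0"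
begin

lemma coeffs_eq:
  assumes "\<iota> a + \<iota> b * H = \<iota> a' + \<iota> b' * H"
  shows "a = a'" "b = b'"
proof -
  have "\<iota> (a - a') + \<iota> (b - b') * H = 0"
    using assms by (simp add: \<iota>_simps algebra_simps)
  then show "a = a'" "b = b'" using indep by force+
qed

lemma s_r_add: "s (a + b) = s a + s b" "r (a + b) = r a + r b"
proof -
  have "\<iota> (r (a + b)) + \<iota> (s (a + b)) * H = \<iota> (r a + r b) + \<iota> (s a + s b) * H"
    using wreath[of "a + b"] wreath[of a] wreath[of b] by (simp add: \<iota>_simps algebra_simps)
  then show "s (a + b) = s a + s b" "r (a + b) = r a + r b" using coeffs_eq by blast+
qed

text \<open>Move \<open>H\<close> past \<open>a\<close>, then past \<open>b\<close>, and compare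
  coefficients: independence of 1 and \<open>H\<close> makes \<open>s\<close> multiplicative and
  \<open>r\<close> a derivation twisted by \<open>s\<close>.\<close>

lemma s_r_mult: "s (a * b) = s a * s b" "r (a * b) = s a * r b + r a * b"
proof -
  have "\<iota> (r (a * b)) + \<iota> (s (a * b)) * H = H * \<iota> a * \<iota> b"
    using wreath[of "a * b"] by (simp add: \<iota>_mult mult.assoc add.commute)
  also have "\<dots> = \<iota> (s a) * (H * \<iota> b) + \<iota> (r a) * \<iota> b"
    by (simp only: wreath[of a] mult.assoc distrib_right)
  also have "\<dots> = \<iota> (s a * r b + r a * b) + \<iota> (s a * s b) * H"
    by (simp add: wreath \<iota>_simps algebra_simps)
  finally show "s (a * b) = s a * s b" "r (a * b) = s a * r b + r a * b" using coeffs_eq by blast+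
qed

lemma s_r_one: "s 1 = 1" "r 1 = 0"
proof -
  have "\<iota> (r 1) + \<iota> (s 1) * H = \<iota> 0 + \<iota> 1 * H"
    using wreath[of 1] by (simp add: \<iota>_simps add.commute)
  then show "s 1 = 1" "r 1 = 0" using coeffs_eq by blast+
qed

lemma s_r_zero: "s 0 = 0" "r 0 = 0"
  using s_r_add[of 0 0] by simp_all

lemma s_r_minus: "s (- a) = - s a" "r (- a) = - r a"
  using s_r_add[of a "- a"] by (simp_all add: s_r_zero add_eq_0_iff)

lemma s_r_diff: "s (a - b) = s a - s b" "r (a - b) = r a - r b"
  using s_r_add[of a "- b"] by (simp_all add: s_r_minus)

text \<open>Coefficient of \<open>H\<close> in \<open>H * (H * H) = (H * H) * H\<close>. It
  expresses \<open>r S\<close> through \<open>s\<close>, so that the constant term in the square of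
  \<open>G\<close> loses its \<open>r\<close>.\<close>

lemma cubic: "s S * S + r S + s R = S * S + R"
proof -
  have "\<iota> (s S * R + r R) + \<iota> (s S * S + r S + s R) * H = (H * \<iota> S) * H + H * \<iota> R"
    by (simp add: wreath \<iota>_simps quad algebra_simps)
  also have "\<dots> = H * (H * H)" by (simp add: quad algebra_simps)
  also have "\<dots> = (H * H) * H" by (simp add: mult.assoc)
  also have "\<dots> = \<iota> S * (H * H) + \<iota> R * H" by (subst quad) (simp add: algebra_simps)
  also have "\<dots> = \<iota> (S * R) + \<iota> (S * S + R) * H"
    by (simp add: \<iota>_simps quad algebra_simps)
  finally show ?thesis using coeffs_eq by blast
qed

end

text \<open>A ring automorphism $h$ of the coefficients, together with $H \mapsto S - H$, is a candidate
  endomorphism of the ambient ring.\<close>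

locale hecke_gen_hash = hecke_gen \<iota> for \<iota> :: "'t::ring_1 \<Rightarrow> 'w::ring_1" +
  fixes h hi :: "'t \<Rightarrow> 't"
  assumes h_add: "h (a + b) = h a + h b"
    and h_mult: "h (a * b) = h a * h b"
    and h_hi: "h (hi a) = a"
    and hi_h: "hi (h a) = a"
begin

abbreviation "G \<equiv> \<iota> S - H"
abbreviation "K \<equiv> \<iota> (hi S) - H"

lemma h_zero: "h 0 = 0" using h_add[of 0 0] by simp
lemma h_minus: "h (- a) = - h a"
  using h_add[of a "- a"] by (simp add: h_zero add_eq_0_iff)
lemma h_diff: "h (a - b) = h a - h b"
  using h_add[of a "- b"] by (simp add: h_minus)
lemma h_inj: "h a = h b \<Longrightarrow> a = b" by (metis hi_h)

text \<open>Both sides are brought to normal form. The \<open>H\<close> coefficients give the first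
  conjunct, which then rewrites the equation of the constant terms into the second.\<close>

lemma hash_wreath_iff:
  "G * \<iota> (h b) = \<iota> (h (s b)) * G + \<iota> (h (r b)) \<longleftrightarrow>
     s (h b) = h (s b) \<and> S * h b - s (h b) * S = r (h b) + h (r b)"
proof -
  have L: "G * \<iota> (h b) = \<iota> (S * h b - r (h b)) + \<iota> (- s (h b)) * H"
    by (simp add: wreath \<iota>_simps algebra_simps)
  have R: "\<iota> (h (s b)) * G + \<iota> (h (r b)) = \<iota> (h (s b) * S + h (r b)) + \<iota> (- h (s b)) * H"
    by (simp add: \<iota>_simps algebra_simps)
  show ?thesis unfolding L R
    using coeffs_eq[of "S * h b - r (h b)" "- s (h b)" "h (s b) * S + h (r b)" "- h (s b)"]
    by (auto simp: algebra_simps)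
qed

lemma hash_quad_iff:
  "G * G = \<iota> (h S) * G + \<iota> (h R) \<longleftrightarrow> s S = h S \<and> s R = h R"
proof -
  have L: "G * G = \<iota> (S * S + R - r S) + \<iota> (- s S) * H"
    by (simp add: wreath \<iota>_simps quad algebra_simps)
  have R: "\<iota> (h S) * G + \<iota> (h R) = \<iota> (h S * S + h R) + \<iota> (- h S) * H"
    by (simp add: \<iota>_simps algebra_simps)
  \<comment> \<open>With \<open>r S\<close> eliminated, the constant terms differ only in
    \<open>s R\<close> and \<open>h R\<close> once the \<open>H\<close> coefficients agree.\<close>
  have c: "S * S + R - r S = s S * S + s R" using cubic by (simp add: algebra_simps)
  show ?thesis unfolding L R c
    using coeffs_eq[of "s S * S + s R" "- s S" "h S * S + h R" "- h S"]
    by auto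
qed

end

locale hecke_gen_hash_compat = hecke_gen_hash +
  assumes s_S: "s S = h S" and s_R: "s R = h R"
    and s_h: "s (h b) = h (s b)"
    and r_h: "S * h b - s (h b) * S = r (h b) + h (r b)"
begin

lemma hash_wreath: "G * \<iota> (h b) = \<iota> (h (s b)) * G + \<iota> (h (r b))"
  using hash_wreath_iff s_h r_h by blast

lemma hash_quad: "G * G = \<iota> (h S) * G + \<iota> (h R)"
  using hash_quad_iff s_S s_R by blast

lemma s_hi: "s (hi b) = hi (s b)"
  by (metis h_hi hi_h s_h)

lemma s_hi_S: "s (hi S) = S"
  by (simp add: s_hi s_S hi_h)

text \<open>\<open>h\<close> is injective and maps the claim to \<open>r_h\<close>; this is
  condition (2) in the form needed for the map with \<open>hi\<close> in place of
  \<open>h\<close>.\<close>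

lemma r_hi: "hi S * b - s b * hi S = r b + hi (r (h b))"
proof (rule h_inj)
  show "h (hi S * b - s b * hi S) = h (r b + hi (r (h b)))"
    using r_h[of b] by (simp add: h_add h_diff h_mult h_hi s_h algebra_simps)
qed

lemma hash_inv_wreath: "K * \<iota> (hi b) = \<iota> (hi (s b)) * K + \<iota> (hi (r b))"
  using arg_cong[OF r_hi[of "hi b"], of \<iota>]
  by (simp add: wreath \<iota>_simps s_hi h_hi algebra_simps)

lemma hash_inv_quad: "K * K = \<iota> (hi S) * K + \<iota> (hi R)"
proof -
  \<comment> \<open>The square of \<open>K\<close> has the wanted value exactly when this holds. Its
    image under \<open>h\<close> results from \<open>cubic\<close> and from \<open>r_h\<close> at
    \<open>hi S\<close>.\<close>
  have "R = hi R + r (hi S)"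
  proof (rule h_inj)
    have "h S * S + r S + h R = S * S + R" using cubic s_S s_R by simp
    moreover have "S * S - h S * S = r S + h (r (hi S))"
      using r_h[of "hi S"] by (simp add: h_hi s_S)
    ultimately have "S * S + (h R + r S) - S * S - r S = S * S + R - h S * S - r S "
      by (simp add: algebra_simps)
    also have "\<dots> = R + h (r (hi S))"
      using \<open>S * S - h S * S = r S + h (r (hi S))\<close> by (simp add: algebra_simps)
    finally have e: "h R = R + h (r (hi S))" by simp
    show "h R = h (hi R + r (hi S))"
      by (subst e) (simp add: h_add h_hi)
  qed
  from arg_cong[OF this, of \<iota>] show ?thesis
    by (simp add: wreath \<iota>_simps quad s_hi_S algebra_simps)
qed

end

section \<open>Two adjacent generators; the six words in \<open>indep6\<close> stand for the
  elements of a copy of the symmetric group on three points\<close>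

locale hecke_pair =
  one: hecke_gen \<iota> S1 R1 s1 r1 H1 + two: hecke_gen \<iota> S2 R2 s2 r2 H2
  for \<iota> :: "'t::ring_1 \<Rightarrow> 'w::ring_1" and S1 R1 s1 r1 H1 S2 R2 s2 r2 H2 +
  assumes braid: "H1 * H2 * H1 = H2 * H1 * H2"
    and indep6: "\<iota> a + \<iota> b * H1 + \<iota> c * H2 + \<iota> x * (H1 * H2) + \<iota> y * (H2 * H1)
                  + \<iota> z * (H1 * H2 * H1) = 0
        \<Longrightarrow> a = 0 \<and> b = 0 \<and> c = 0 \<and> x = 0 \<and> y = 0 \<and> z = 0"
begin

lemmas \<iota>_simps = one.\<iota>_simps

lemma swap: "hecke_pair \<iota> S2 R2 s2 r2 H2 S1 R1 s1 r1 H1"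
proof unfold_locales
  show "H2 * H1 * H2 = H1 * H2 * H1" using braid by simp
next
  fix a b c x y z
  assume "\<iota> a + \<iota> b * H2 + \<iota> c * H1 + \<iota> x * (H2 * H1) + \<iota> y * (H1 * H2) + \<iota> z * (H2 * H1 * H2) = 0"
  then have "\<iota> a + \<iota> c * H1 + \<iota> b * H2 + \<iota> y * (H1 * H2) + \<iota> x * (H2 * H1) + \<iota> z * (H1 * H2 * H1) = 0"
    unfolding braid by (simp add: add_ac)
  from indep6[OF this] show "a = 0 \<and> b = 0 \<and> c = 0 \<and> x = 0 \<and> y = 0 \<and> z = 0" by simp
qed

lemma coeffs6_eq:
  assumes "\<iota> a + \<iota> b * H1 + \<iota> c * H2 + \<iota> x * (H1 * H2) + \<iota> y * (H2 * H1) + \<iota> z * (H1 * H2 * H1)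
    = \<iota> a' + \<iota> b' * H1 + \<iota> c' * H2 + \<iota> x' * (H1 * H2) + \<iota> y' * (H2 * H1) + \<iota> z' * (H1 * H2 * H1)"
  shows "a = a'" "b = b'" "c = c'" "x = x'" "y = y'" "z = z'"
proof -
  have "\<iota> (a - a') + \<iota> (b - b') * H1 + \<iota> (c - c') * H2 + \<iota> (x - x') * (H1 * H2)
    + \<iota> (y - y') * (H2 * H1) + \<iota> (z - z') * (H1 * H2 * H1) = 0"
    using assms by (simp add: \<iota>_simps left_diff_distrib) (simp add: algebra_simps)
  from indep6[OF this] show "a = a'" "b = b'" "c = c'" "x = x'" "y = y'" "z = z'" by simp_all
qed

text \<open>Forms of the relations for words that continue to the right; after
  \<open>mult.assoc\<close> they let the simplifier reach the normal form.\<close>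

lemma wreath': "H1 * (\<iota> b * w) = \<iota> (s1 b) * (H1 * w) + \<iota> (r1 b) * w"
  by (metis one.wreath mult.assoc distrib_right)

lemma quad': "H1 * (H1 * w) = \<iota> S1 * (H1 * w) + \<iota> R1 * w"
  by (metis one.quad mult.assoc distrib_right)

end

text \<open>The lemmas braid_wreath_r_s_s and braid_quad evaluate $(H_1 H_2 H_1) b$ and
  $(H_1 H_2 H_1) H_1$ in two ways. Here and below a new context block is opened whenever
  preceding results are needed with the roles of the two generators exchanged.\<close>

context hecke_pair
begin

interpretation sw: hecke_pair \<iota> S2 R2 s2 r2 H2 S1 R1 s1 r1 H1 by (rule swap)

lemmas push = one.wreath two.wreath wreath' sw.wreath' one.quad two.quad quad' sw.quad'
lemmas collect = \<iota>_simps mult.assoc distrib_left distrib_right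

lemma braid_wreath_r_s_s: "r1 (s2 (s1 b)) = s2 (s1 (r2 b))"
proof -
  have e: "H1 * H2 * H1 * \<iota> b
    = \<iota> (s1 (r2 (s1 b)) * R1 + r1 (r2 (r1 b)))
    + \<iota> (s1 (r2 (s1 b)) * S1 + r1 (r2 (s1 b)) + s1 (r2 (r1 b))) * H1
    + \<iota> (r1 (s2 (r1 b))) * H2
    + \<iota> (s1 (s2 (r1 b))) * (H1 * H2)
    + \<iota> (r1 (s2 (s1 b))) * (H2 * H1)
    + \<iota> (s1 (s2 (s1 b))) * (H1 * H2 * H1)"
    by (simp add: push mult.assoc distrib_left) (simp add: collect)
  have e': "H2 * H1 * H2 * \<iota> b
    = \<iota> (s2 (r1 (s2 b)) * R2 + r2 (r1 (r2 b)))
    + \<iota> (r2 (s1 (r2 b))) * H1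
    + \<iota> (s2 (r1 (s2 b)) * S2 + r2 (r1 (s2 b)) + s2 (r1 (r2 b))) * H2
    + \<iota> (r2 (s1 (s2 b))) * (H1 * H2)
    + \<iota> (s2 (s1 (r2 b))) * (H2 * H1)
    + \<iota> (s2 (s1 (s2 b))) * (H1 * H2 * H1)"
    unfolding braid
    by (simp add: push mult.assoc distrib_left) (simp add: collect)
  \<comment> \<open>The fifth coefficient is that of \<open>H2 * H1\<close>.\<close>
  from e e' show ?thesis
    using coeffs6_eq(5)[OF trans[OF e[symmetric] trans[OF _ e']]] braid by simp
qed

lemma braid_quad:
  shows s_s_S: "s1 (s2 S1) = S2" and r_s_S: "r1 (s2 S1) = 0"
    and s_s_R: "s1 (s2 R1) = R2" and r_s_R: "r1 (s2 R1) = 0"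
    and s_r_S: "s1 (r2 S1) * S1 + r1 (r2 S1) + s1 (r2 R1) = 0"
    and s_r_R: "s1 (r2 S1) * R1 + r1 (r2 R1) = 0"
proof -
  have e: "H1 * H2 * (H1 * H1)
    = \<iota> (s1 (r2 S1) * R1 + r1 (r2 R1))
    + \<iota> (s1 (r2 S1) * S1 + r1 (r2 S1) + s1 (r2 R1)) * H1
    + \<iota> (r1 (s2 R1)) * H2
    + \<iota> (s1 (s2 R1)) * (H1 * H2)
    + \<iota> (r1 (s2 S1)) * (H2 * H1)
    + \<iota> (s1 (s2 S1)) * (H1 * H2 * H1)"
    by (simp add: push mult.assoc distrib_left) (simp add: collect)
  \<comment> \<open>Braiding carries the last \<open>H1\<close> to the front as \<open>H2\<close>,
    so the second evaluation uses the quadratic relation of the other generator.\<close>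
  have "H1 * H2 * (H1 * H1) = (H1 * H2 * H1) * H1" by (simp add: mult.assoc)
  also have "\<dots> = H2 * (H1 * H2 * H1)" by (subst braid) (simp add: mult.assoc)
  also have "\<dots> = H2 * (H2 * (H1 * H2))" by (subst braid) (simp add: mult.assoc)
  also have "\<dots> = \<iota> S2 * (H2 * H1 * H2) + \<iota> R2 * (H1 * H2)" by (simp add: sw.quad' mult.assoc)
  also have "\<dots> = \<iota> 0 + \<iota> 0 * H1 + \<iota> 0 * H2 + \<iota> R2 * (H1 * H2) + \<iota> 0 * (H2 * H1)
      + \<iota> S2 * (H1 * H2 * H1)"
    unfolding braid by (simp add: \<iota>_simps)
  finally have e': "H1 * H2 * (H1 * H1) = \<dots>" .
  note c = coeffs6_eq[OF trans[OF e[symmetric] e']]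
  show "s1 (s2 S1) = S2" "r1 (s2 S1) = 0" "s1 (s2 R1) = R2" "r1 (s2 R1) = 0"
    "s1 (r2 S1) * S1 + r1 (r2 S1) + s1 (r2 R1) = 0" "s1 (r2 S1) * R1 + r1 (r2 R1) = 0"
    using c by simp_all
qed

text \<open>Constant term of a single triple product. \<open>x1\<close> and \<open>x2\<close> stay
  free because the endomorphism uses \<open>S1\<close>, \<open>S2\<close> and its inverse uses
  \<open>hi S1\<close>, \<open>hi S2\<close>.\<close>

definition "defectA x1 x2 = x1 * x2 * x1 - x1 * r2 x1 - r1 (x2 * x1) + s1 x2 * R1 + r1 (r2 x1)"
text \<open>Unlike \<open>defectA\<close>, this belongs to the difference of both triples: the last
  bracket is the \<open>H1\<close> coefficient of the triple with the generators exchanged.\<close>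

definition "defectB x1 x2 = - (x1 * x2) - s1 (x2 * x1) + s1 x2 * S1 + r1 x2 + s1 (r2 x1)
   - (r2 (s1 x2) - x2 * s1 x2)"

lemma triple_expand:
  "(\<iota> x1 - H1) * (\<iota> x2 - H2) * (\<iota> x1 - H1)
    = \<iota> (defectA x1 x2)
    + \<iota> (- (x1 * x2) - s1 (x2 * x1) + s1 x2 * S1 + r1 x2 + s1 (r2 x1)) * H1
    + \<iota> (r1 (s2 x1) - x1 * s2 x1) * H2
    + \<iota> (s1 (s2 x1)) * (H1 * H2) + \<iota> x1 * (H2 * H1) - H1 * H2 * H1"
proof -
  have "(\<iota> x1 - H1) * (\<iota> x2 - H2) * (\<iota> x1 - H1)
    = \<iota> (x1 * x2 * x1) - \<iota> (x1 * x2) * H1 - \<iota> x1 * (H2 * \<iota> x1) - H1 * \<iota> (x2 * x1)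
      + \<iota> x1 * (H2 * H1) + H1 * \<iota> x2 * H1 + H1 * (H2 * \<iota> x1) - H1 * H2 * H1"
    by (simp add: one.\<iota>_mult algebra_simps)
  also have "H1 * \<iota> x2 * H1 = \<iota> (s1 x2 * S1 + r1 x2) * H1 + \<iota> (s1 x2 * R1)"
    by (simp add: push distrib_right mult.assoc distrib_left) (simp add: collect add_ac)
  also have "H1 * (H2 * \<iota> x1) = \<iota> (s1 (s2 x1)) * (H1 * H2) + \<iota> (r1 (s2 x1)) * H2
      + \<iota> (s1 (r2 x1)) * H1 + \<iota> (r1 (r2 x1))"
    by (simp add: push mult.assoc distrib_left)
  also have "\<iota> x1 * (H2 * \<iota> x1) = \<iota> (x1 * s2 x1) * H2 + \<iota> (x1 * r2 x1)"
    by (simp add: push collect)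
  also have "H1 * \<iota> (x2 * x1) = \<iota> (s1 (x2 * x1)) * H1 + \<iota> (r1 (x2 * x1))"
    by (simp add: push)
  finally show ?thesis
    by (simp add: defectA_def one.\<iota>_add one.\<iota>_diff one.\<iota>_minus left_diff_distrib distrib_right)
qed

end

context hecke_pair
begin

interpretation sw: hecke_pair \<iota> S2 R2 s2 r2 H2 S1 R1 s1 r1 H1 by (rule swap)

text \<open>The two assumptions are the equality of the length-two coefficients of both triples; the
  length-three terms cancel by \<open>braid\<close>.\<close>

lemma defect_expand:
  assumes "s1 (s2 x1) = x2" "s2 (s1 x2) = x1"
  shows "(\<iota> x1 - H1) * (\<iota> x2 - H2) * (\<iota> x1 - H1) - (\<iota> x2 - H2) * (\<iota> x1 - H1) * (\<iota> x2 - H2)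
    = \<iota> (defectA x1 x2 - sw.defectA x2 x1) + \<iota> (defectB x1 x2) * H1 + \<iota> (- sw.defectB x2 x1) * H2"
  unfolding triple_expand sw.triple_expand assms defectB_def sw.defectB_def braid
  by (simp add: one.\<iota>_add one.\<iota>_diff one.\<iota>_minus left_diff_distrib distrib_right)

end

section \<open>The braid defect of the images of two adjacent generators\<close>

locale hecke_pair_hash = hecke_pair \<iota> S1 R1 s1 r1 H1 S2 R2 s2 r2 H2 +
  one: hecke_gen_hash_compat S1 R1 s1 r1 H1 \<iota> h hi +
  two: hecke_gen_hash_compat S2 R2 s2 r2 H2 \<iota> h hi
  for \<iota> :: "'t::ring_1 \<Rightarrow> 'w::ring_1" and S1 R1 s1 r1 H1 S2 R2 s2 r2 H2 h hi
begin

lemma swap_hash: "hecke_pair_hash \<iota> S2 R2 s2 r2 H2 S1 R1 s1 r1 H1 h hi"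
proof -
  interpret sw: hecke_pair \<iota> S2 R2 s2 r2 H2 S1 R1 s1 r1 H1 by (rule swap)
  show ?thesis ..
qed

end

context hecke_pair_hash
begin

interpretation sw: hecke_pair_hash \<iota> S2 R2 s2 r2 H2 S1 R1 s1 r1 H1 h hi by (rule swap_hash)

lemma s_s_hi_S: "s1 (s2 (hi S1)) = hi S2"
  by (simp add: one.s_hi two.s_hi s_s_S)

text \<open>Condition (2) at \<open>hi S2\<close>, and at \<open>hi S1\<close> under
  \<open>s1\<close>, absorbs every product; the bracket from the exchanged triple simplifies by
  \<open>r2 (s1 S2) = 0\<close>.\<close>

lemma defectB_S: "defectB S1 S2 = - h (r1 (hi S2)) - h (s1 (r2 (hi S1)))"
proof -
  have "S1 * S2 - s1 S2 * S1 = r1 S2 + h (r1 (hi S2))"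
    using one.r_h[of "hi S2"] by (simp add: one.h_hi)
  moreover have "s1 S2 * s1 S1 - S2 * s1 S2 = s1 (r2 S1) + h (s1 (r2 (hi S1)))"
    using arg_cong[OF two.r_h[of "hi S1"], of s1]
    by (simp add: one.h_hi one.s_r_diff one.s_r_add one.s_r_mult s_s_S one.s_h)
  moreover have "r2 (s1 S2) = 0" by (rule sw.r_s_S)
  ultimately show ?thesis
    unfolding defectB_def one.s_r_mult by (simp add: algebra_simps)
qed

text \<open>\<open>braid_wreath_r_s_s\<close> moves \<open>r\<close> outermost; there
  \<open>s1 (hi S1) = S1\<close> reduces everything to \<open>r1 (s2 S1) = 0\<close> and its mirror
  image.\<close>

lemma s_s_defectB: "s1 (s2 (defectB S1 S2)) = 0"
proof -
  have "s2 (s1 (r2 (hi S1))) = 0"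
    using braid_wreath_r_s_s[of "hi S1"] by (simp add: one.s_hi_S r_s_S)
  moreover have "s1 (s2 (r1 (hi S2))) = 0"
    using sw.braid_wreath_r_s_s[of "hi S2"] by (simp add: two.s_hi_S sw.r_s_S)
  ultimately show ?thesis
    unfolding defectB_S
    by (simp add: one.s_h two.s_h one.s_r_diff two.s_r_diff one.s_r_minus two.s_r_minus
        one.h_zero one.s_r_zero)
qed

abbreviation "G1 \<equiv> \<iota> S1 - H1"
abbreviation "G2 \<equiv> \<iota> S2 - H2"
abbreviation "defect \<equiv> G1 * G2 * G1 - G2 * G1 * G2"

text \<open>Only the quadratic and wreath relations of \<open>G1\<close>, \<open>G2\<close> are
  used. Pushing the coefficients of \<open>G1 * G1\<close> through \<open>G1 * G2\<close> yields
  those of \<open>G2 * G2\<close>, by the identities of \<open>braid_quad\<close> under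
  \<open>h\<close>.\<close>

lemma defect_G: "defect * G1 = (\<iota> (h S2) - G2) * defect"
proof -
  have "G1 * \<iota> (h b) = \<iota> (h (s1 b)) * G1 + \<iota> (h (r1 b))" for b by (rule one.hash_wreath)
  then have w1: "G1 * (\<iota> (h b) * w) = \<iota> (h (s1 b)) * (G1 * w) + \<iota> (h (r1 b)) * w" for b w
    by (metis mult.assoc distrib_right)
  have "G2 * \<iota> (h b) = \<iota> (h (s2 b)) * G2 + \<iota> (h (r2 b))" for b by (rule two.hash_wreath)
  then have w2: "G2 * (\<iota> (h b) * w) = \<iota> (h (s2 b)) * (G2 * w) + \<iota> (h (r2 b)) * w" for b w
    by (metis mult.assoc distrib_right)
  \<comment> \<open>These will be the coefficient of \<open>G1\<close> and the constant term of
    \<open>G1 * (G2 * (G1 * G1))\<close>.\<close>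
  have h0: "h (s1 (r2 S1)) * h S1 + h (r1 (r2 S1)) + h (s1 (r2 R1)) = 0"
     "h (s1 (r2 S1)) * h R1 + h (r1 (r2 R1)) = 0"
    using s_r_S s_r_R by (metis one.h_add one.h_mult one.h_zero)+
  have "G1 * (G2 * (G1 * G1)) = G1 * (G2 * (\<iota> (h S1) * G1)) + G1 * (G2 * \<iota> (h R1))"
    by (simp only: one.hash_quad distrib_left)
  also have "G1 * (G2 * \<iota> (h R1)) = \<iota> (h R2) * (G1 * G2) + \<iota> (h (s1 (r2 R1))) * G1 + \<iota> (h (r1 (r2 R1)))"
    by (simp only: one.hash_wreath two.hash_wreath distrib_left w1 s_s_R r_s_R one.h_zero one.\<iota>_zero)
      (simp add: algebra_simps)
  also have "G1 * (G2 * (\<iota> (h S1) * G1)) = \<iota> (h S2) * (G1 * (G2 * G1))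
       + (\<iota> (h (s1 (r2 S1))) * (G1 * G1) + \<iota> (h (r1 (r2 S1))) * G1)"
    by (simp only: w2 distrib_left w1 s_s_S r_s_S one.h_zero one.\<iota>_zero)
      (simp only: mult_zero_left add_0_right add.assoc)
  also have "\<iota> (h (s1 (r2 S1))) * (G1 * G1) = \<iota> (h (s1 (r2 S1)) * h S1) * G1 + \<iota> (h (s1 (r2 S1)) * h R1)"
    by (simp only: one.hash_quad one.\<iota>_mult distrib_left mult.assoc)
  also have "\<iota> (h S2) * (G1 * (G2 * G1))
      + (\<iota> (h (s1 (r2 S1)) * h S1) * G1 + \<iota> (h (s1 (r2 S1)) * h R1) + \<iota> (h (r1 (r2 S1))) * G1)
      + (\<iota> (h R2) * (G1 * G2) + \<iota> (h (s1 (r2 R1))) * G1 + \<iota> (h (r1 (r2 R1))))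
    = \<iota> (h S2) * (G1 * (G2 * G1)) + \<iota> (h R2) * (G1 * G2)
      + \<iota> (h (s1 (r2 S1)) * h S1 + h (r1 (r2 S1)) + h (s1 (r2 R1))) * G1
      + \<iota> (h (s1 (r2 S1)) * h R1 + h (r1 (r2 R1)))"
    by (simp only: one.\<iota>_add distrib_right ac_simps)
  finally have 1: "G1 * (G2 * (G1 * G1)) = \<iota> (h S2) * (G1 * (G2 * G1)) + \<iota> (h R2) * (G1 * G2)"
    unfolding h0 by (simp add: one.\<iota>_zero)
  have 2: "G2 * (G2 * (G1 * G2)) = \<iota> (h S2) * (G2 * (G1 * G2)) + \<iota> (h R2) * (G1 * G2)"
    by (metis two.hash_quad mult.assoc distrib_right)
  \<comment> \<open>Both assumptions share the tail \<open>Q * (X * Y)\<close>, which drops out of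
    the difference; the rest is associativity.\<close>
  have "X * (Y * (X * X)) = P * (X * (Y * X)) + Q * (X * Y) \<Longrightarrow>
        Y * (Y * (X * Y)) = P * (Y * (X * Y)) + Q * (X * Y) \<Longrightarrow>
        (X * Y * X - Y * X * Y) * X = (P - Y) * (X * Y * X - Y * X * Y)" for X Y P Q :: 'w
    by (simp add: left_diff_distrib right_diff_distrib mult.assoc)
  from this[OF 1 2] show ?thesis .
qed

text \<open>Coefficient of \<open>H2 * H1\<close> in \<open>defect_G\<close>: on the left it arises
  from the \<open>H2\<close> term of the defect times \<open>- H1\<close>, on the right from
  \<open>H2\<close> times the \<open>H1\<close> term.\<close>

lemma defect_top: "s2 (defectB S1 S2) = sw.defectB S2 S1"
proof -
  let ?A = "defectA S1 S2 - sw.defectA S2 S1" and ?B = "defectB S1 S2" and ?C = "- sw.defectB S2 S1"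
  let ?t = "h S2 - S2"
  have D: "defect = \<iota> ?A + \<iota> ?B * H1 + \<iota> ?C * H2"
    by (rule defect_expand) (rule s_s_S sw.s_s_S)+
  \<comment> \<open>Stated for arbitrary coefficients so that the long defect terms stay folded
    during normalization.\<close>
  have top: "s2 B = - C" if D: "defect = \<iota> A + \<iota> B * H1 + \<iota> C * H2" for A B C
  proof -
    have 1: "defect * G1 = \<iota> (A * S1 + C * r2 S1 - B * R1 + B * r1 S1) +
        \<iota> (B * s1 S1 - A - B * S1) * H1 + \<iota> (C * s2 S1) * H2 + \<iota> 0 * (H1 * H2) + \<iota> (- C) * (H2 * H1)
        + \<iota> 0 * (H1 * H2 * H1)"
      unfolding D unfolding right_diff_distrib
      by (simp add: push mult.assoc distrib_left distrib_right) (simp add: \<iota>_simps algebra_simps)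
    have e: "\<iota> (h S2) - G2 = \<iota> ?t + H2" by (simp add: one.\<iota>_diff)
    have 2: "(\<iota> (h S2) - G2) * defect = \<iota> (?t * A + r2 A + s2 C * R2) + \<iota> (?t * B + r2 B) * H1
         + \<iota> (?t * C + s2 A + r2 C + s2 C * S2) * H2 + \<iota> 0 * (H1 * H2) + \<iota> (s2 B) * (H2 * H1)
        + \<iota> 0 * (H1 * H2 * H1)"
      unfolding D unfolding e distrib_right
      by (simp add: push mult.assoc distrib_left) (simp add: \<iota>_simps algebra_simps)
    show ?thesis
      using coeffs6_eq(5)[OF trans[OF 1[symmetric] trans[OF defect_G 2]]] by simp
  qed
  show ?thesis using top[OF D] by simp
qed

end

context hecke_pair_hash
begin

interpretation sw: hecke_pair_hash \<iota> S2 R2 s2 r2 H2 S1 R1 s1 r1 H1 h hi by (rule swap_hash)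

text \<open>\<open>defect_top\<close> and its mirror image make this element a fixed point of
  \<open>s1\<close> after \<open>s2\<close>, and that composition annihilates it.\<close>

lemma defectB_zero: "defectB S1 S2 = 0"
  using s_s_defectB sw.defect_top unfolding defect_top by simp

end

context hecke_pair_hash
begin

interpretation sw: hecke_pair_hash \<iota> S2 R2 s2 r2 H2 S1 R1 s1 r1 H1 h hi by (rule swap_hash)

text \<open>With the defect reduced to a coefficient \<open>A\<close>, the left side of
  \<open>defect_G\<close> contains \<open>- A\<close> at \<open>H1\<close> and the right side has no
  \<open>H1\<close> term.\<close>

lemma defectA_swap: "defectA S1 S2 = sw.defectA S2 S1"
  and braid_hash: "G1 * G2 * G1 = G2 * G1 * G2"
proof -
  define A where "A = defectA S1 S2 - sw.defectA S2 S1"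
  have D: "defect = \<iota> A"
    using defect_expand[OF s_s_S sw.s_s_S] by (simp add: A_def defectB_zero sw.defectB_zero one.\<iota>_zero)
  have "\<iota> (A * S1) + \<iota> (- A) * H1 = defect * G1"
    unfolding D by (simp add: one.\<iota>_mult one.\<iota>_minus right_diff_distrib mult.assoc)
  also have "\<dots> = \<iota> ((h S2 - S2) * A + r2 A) + \<iota> (s2 A) * H2"
    unfolding defect_G unfolding D
    by (simp add: two.wreath \<iota>_simps algebra_simps)
  finally have "\<iota> (A * S1) + \<iota> (- A) * H1 + \<iota> 0 * H2 + \<iota> 0 * (H1 * H2) + \<iota> 0 * (H2 * H1)
     + \<iota> 0 * (H1 * H2 * H1)
    = \<iota> ((h S2 - S2) * A + r2 A) + \<iota> 0 * H1 + \<iota> (s2 A) * H2 + \<iota> 0 * (H1 * H2) + \<iota> 0 * (H2 * H1)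
     + \<iota> 0 * (H1 * H2 * H1)"
    by (simp add: one.\<iota>_zero)
  from coeffs6_eq(2)[OF this] have "A = 0" by simp
  then show "defectA S1 S2 = sw.defectA S2 S1" by (simp add: A_def)
  show "G1 * G2 * G1 = G2 * G1 * G2" using D \<open>A = 0\<close> by (simp add: one.\<iota>_zero)
qed

lemma r_hi_S_aux: "s1 (r2 (hi S1)) = - r1 (hi S2)"
proof -
  have "h (r1 (hi S2) + s1 (r2 (hi S1))) = h 0"
    using defectB_zero unfolding defectB_S by (simp add: one.h_add one.h_zero add_eq_0_iff)
  then have "r1 (hi S2) + s1 (r2 (hi S1)) = 0" by (rule one.h_inj)
  then show ?thesis by (simp add: add_eq_0_iff)
qed

end

context hecke_pair_hash
begin

interpretation sw: hecke_pair_hash \<iota> S2 R2 s2 r2 H2 S1 R1 s1 r1 H1 h hi by (rule swap_hash)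

text \<open>The vanishing of \<open>defectB\<close> relates \<open>r1 (hi S2)\<close> and
  \<open>r2 (hi S1)\<close> in both directions. Composing the two relations gives a value of
  \<open>s2\<close> after \<open>s1\<close> that \<open>braid_wreath_r_s_s\<close> already kills.
  The result makes \<open>r2 S1\<close> explicit through condition (2).\<close>

lemma r_hi_S: "r2 (hi S1) = 0"
proof -
  have "s2 (s1 (r2 (hi S1))) = 0"
    using braid_wreath_r_s_s[of "hi S1"] by (simp add: one.s_hi_S r_s_S)
  then have "s2 (r1 (hi S2)) = 0"
    by (simp add: r_hi_S_aux two.s_r_minus)
  then show ?thesis using sw.r_hi_S_aux by simp
qed

lemma r_S: "r2 S1 = S2 * S1 - s2 S1 * S2"
  using two.r_h[of "hi S1"] by (simp add: two.h_hi r_hi_S two.h_zero)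

text \<open>Substituting \<open>r_S\<close> rewrites the double \<open>r\<close>. The subtracted
  bracket is symmetric in the two generators, so \<open>defectA_swap\<close> turns into condition
  (3).\<close>

lemma defectA_S: "defectA S1 S2 = S1 * S2 * S1 + s1 S2 * R1 - (S1 * r2 S1 + S2 * r1 S2)"
proof -
  have "r1 (r2 S1) = r1 (S2 * S1) - S2 * r1 S2"
    by (subst r_S) (simp add: one.s_r_diff one.s_r_mult(2)[of "s2 S1"] s_s_S r_s_S)
  then show ?thesis unfolding defectA_def by (simp add: algebra_simps)
qed

end

context hecke_pair_hash
begin

interpretation sw: hecke_pair_hash \<iota> S2 R2 s2 r2 H2 S1 R1 s1 r1 H1 h hi by (rule swap_hash)

lemma hash_cond3: "S1 * S2 * S1 + s1 S2 * R1 = S2 * S1 * S2 + s2 S1 * R2"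
  using defectA_swap unfolding defectA_S sw.defectA_S by simp

text \<open>\<open>f\<close> sends the two factors to \<open>H1\<close> and \<open>H2\<close>, hence
  their braid defect to 0. The defect has the shape given by \<open>defect_expand\<close>, and on
  that shape \<open>f\<close> is injective, so its coefficients need not be computed.\<close>

lemma braid_hash_inv:
  assumes f: "f \<circ> \<iota> = \<iota> \<circ> h" "f H1 = G1" "f H2 = G2"
    and add: "\<And>x y. f (x + y) = f x + f y" and mult: "\<And>x y. f (x * y) = f x * f y"
  shows "(\<iota> (hi S1) - H1) * (\<iota> (hi S2) - H2) * (\<iota> (hi S1) - H1)
       = (\<iota> (hi S2) - H2) * (\<iota> (hi S1) - H1) * (\<iota> (hi S2) - H2)" (is "?K1 * ?K2 * ?K1 = _")
proof -
  define A B C where "A = defectA (hi S1) (hi S2) - sw.defectA (hi S2) (hi S1)"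
    and "B = defectB (hi S1) (hi S2)" and "C = - sw.defectB (hi S2) (hi S1)"
  have D: "?K1 * ?K2 * ?K1 - ?K2 * ?K1 * ?K2 = \<iota> A + \<iota> B * H1 + \<iota> C * H2"
    unfolding A_def B_def C_def by (rule defect_expand) (rule s_s_hi_S sw.s_s_hi_S)+
  have diff: "f (x - y) = f x - f y" for x y
    using add[of "x - y" y] by simp
  have fi: "f (\<iota> a) = \<iota> (h a)" for a using f(1) by (metis comp_apply)
  have K: "f ?K1 = H1" "f ?K2 = H2" by (simp_all add: diff fi f(2,3) one.h_hi)
  have "\<iota> (h A) + \<iota> (h B) * G1 + \<iota> (h C) * G2 = f (\<iota> A + \<iota> B * H1 + \<iota> C * H2)"
    by (simp add: add mult fi f(2,3))
  also have "\<dots> = H1 * H2 * H1 - H2 * H1 * H2"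
    by (subst D[symmetric]) (simp only: diff[of "?K1 * ?K2 * ?K1" "?K2 * ?K1 * ?K2"] mult K)
  also have "\<dots> = 0" using braid by simp
  \<comment> \<open>Triangularity: the coefficients of \<open>H1\<close> and \<open>H2\<close> kill
    \<open>h B\<close> and \<open>h C\<close>, after which the constant term is
    \<open>h A\<close>.\<close>
  finally have "\<iota> (h A + h B * S1 + h C * S2) + \<iota> (- h B) * H1 + \<iota> (- h C) * H2 + \<iota> 0 * (H1 * H2)
      + \<iota> 0 * (H2 * H1) + \<iota> 0 * (H1 * H2 * H1) = 0"
    by (simp add: \<iota>_simps algebra_simps)
  from indep6[OF this] have "h B = 0" "h C = 0" "h A = 0" by auto
  then have "A = 0" "B = 0" "C = 0" by (metis one.h_inj one.h_zero)+
  then show ?thesis using D by (simp add: one.\<iota>_zero)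
qed

end

section \<open>Linear algebra over a basis and multilinear extension\<close>

lemma Kalg_module: "Kalg sm \<Longrightarrow> module sm"
  by (simp add: Kalg_def module_def)

lemma Klin_iff_module_hom:
  "module s1 \<Longrightarrow> module s2 \<Longrightarrow> Klin s1 s2 f \<longleftrightarrow> module_hom s1 s2 f"
  by (auto simp: Klin_def module_hom_def module_hom_axioms_def)

text \<open>A basis is encoded by unique finitely supported coefficient functions; linearity of the
  extension follows from uniqueness applied to sums and multiples of these functions.\<close>

lemma linear_extension:
  assumes s1: "module s1" and s2: "module s2" and b: "is_basis_on s1 I v"
  shows "\<exists>L. Klin s1 s2 L \<and> (\<forall>i\<in>I. L (v i) = \<phi> i)"
proof -
  interpret M: module s1 by fact
  interpret N: module s2 by fact
  define rep where "rep x c \<longleftrightarrow> (\<forall>i. i \<notin> I \<longrightarrow> c i = 0) \<and> finite {i. c i \<noteq> 0} \<and>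
              x = (\<Sum>i\<in>{i. c i \<noteq> 0}. s1 (c i) (v i))" for x c
  from b have ex1: "\<exists>!c. rep x c" for x by (simp add: is_basis_on_def rep_def)
  then obtain c where c: "rep x (c x)" for x by metis
  have uniq: "rep x c' \<Longrightarrow> c x = c'" for x c' using ex1 c by blast
  define L where "L x = (\<Sum>i\<in>{i. c x i \<noteq> 0}. s2 (c x i) (\<phi> i))" for x
  have fin: "finite {i. c x i \<noteq> 0}" for x using c by (simp add: rep_def)
  \<comment> \<open>Sums over the exact support do not add up termwise; any finite set containing
    the support gives a common index set.\<close>
  have L_sup: "L x = (\<Sum>i\<in>A. s2 (c x i) (\<phi> i))" if "finite A" "{i. c x i \<noteq> 0} \<subseteq> A" for x A
    unfolding L_def by (rule sum.mono_neutral_left) (use that in auto)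
  have x_sup: "x = (\<Sum>i\<in>A. s1 (c x i) (v i))" if "finite A" "{i. c x i \<noteq> 0} \<subseteq> A" for x A
  proof -
    have "x = (\<Sum>i\<in>{i. c x i \<noteq> 0}. s1 (c x i) (v i))" using c by (simp add: rep_def)
    also have "\<dots> = (\<Sum>i\<in>A. s1 (c x i) (v i))"
      by (rule sum.mono_neutral_left) (use that in auto)
    finally show ?thesis .
  qed
  have rep_sup: "rep (\<Sum>i\<in>A. s1 (c' i) (v i)) c'" if "finite A" "A \<subseteq> I" "{i. c' i \<noteq> 0} \<subseteq> A" for c' A
    unfolding rep_def
  proof (intro conjI)
    show "(\<Sum>i\<in>A. s1 (c' i) (v i)) = (\<Sum>i\<in>{i. c' i \<noteq> 0}. s1 (c' i) (v i))"
      by (rule sum.mono_neutral_right) (use that in auto)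
  qed (use that finite_subset in auto)
  have sub: "{i. c x i \<noteq> 0} \<subseteq> I" for x using c by (auto simp: rep_def)
  have "Klin s1 s2 L"
    unfolding Klin_def
  proof (intro conjI allI)
    fix x y
    let ?A = "{i. c x i \<noteq> 0} \<union> {i. c y i \<noteq> 0}"
    have fA: "finite ?A" using fin by simp
    have "x + y = (\<Sum>i\<in>?A. s1 (c x i + c y i) (v i))"
      by (simp add: M.scale_left_distrib sum.distrib flip: x_sup[OF fA])
    then have "rep (x + y) (\<lambda>i. c x i + c y i)"
      using rep_sup[OF fA, of "\<lambda>i. c x i + c y i"] sub by force
    then have e: "c (x + y) = (\<lambda>i. c x i + c y i)" by (rule uniq)
    have "L (x + y) = (\<Sum>i\<in>?A. s2 (c (x + y) i) (\<phi> i))"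
      by (rule L_sup[OF fA]) (auto simp: e)
    also have "\<dots> = L x + L y"
      by (simp add: e N.scale_left_distrib sum.distrib flip: L_sup[OF fA])
    finally show "L (x + y) = L x + L y" .
  next
    fix a x
    let ?A = "{i. c x i \<noteq> 0}"
    have "s1 a x = (\<Sum>i\<in>?A. s1 (a * c x i) (v i))"
      by (subst x_sup[OF fin subset_refl]) (simp add: M.scale_sum_right)
    then have "rep (s1 a x) (\<lambda>i. a * c x i)"
      using rep_sup[OF fin[of x], of "\<lambda>i. a * c x i"] sub by force
    then have e: "c (s1 a x) = (\<lambda>i. a * c x i)" by (rule uniq)
    have "L (s1 a x) = (\<Sum>i\<in>?A. s2 (c (s1 a x) i) (\<phi> i))"
      by (rule L_sup[OF fin]) (auto simp: e)
    also have "\<dots> = s2 a (L x)"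
      by (simp add: e L_def N.scale_sum_right)
    finally show "L (s1 a x) = s2 a (L x)" .
  qed
  moreover have "L (v i) = \<phi> i" if "i \<in> I" for i
  proof -
    have "rep (v i) (\<lambda>j. if j = i then 1 else 0)"
      using rep_sup[of "{i}" "\<lambda>j. if j = i then 1 else 0"] that by auto
    then have "c (v i) = (\<lambda>j. if j = i then 1 else 0)" by (rule uniq)
    then show ?thesis using L_sup[of "{i}" "v i"] by auto
  qed
  ultimately show ?thesis by blast
qed

lemma linear_eqI:
  assumes "module s1" "module s2" and b: "is_basis_on s1 I v"
    and F: "Klin s1 s2 F" and G: "Klin s1 s2 G" and eq: "\<And>i. i \<in> I \<Longrightarrow> F (v i) = G (v i)"
  shows "F x = G x"
proof -
  interpret F: module_hom s1 s2 F using assms Klin_iff_module_hom by blast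
  interpret G: module_hom s1 s2 G using assms Klin_iff_module_hom by blast
  from b obtain c where c: "\<forall>i. i \<notin> I \<longrightarrow> c i = 0"
    and x: "x = (\<Sum>i\<in>{i. c i \<noteq> 0}. s1 (c i) (v i))"
    unfolding is_basis_on_def by metis
  have "F x = (\<Sum>i\<in>{i. c i \<noteq> 0}. s2 (c i) (F (v i)))"
    by (subst x) (simp add: F.sum F.scale)
  also have "\<dots> = (\<Sum>i\<in>{i. c i \<noteq> 0}. s2 (c i) (G (v i)))"
  proof (rule sum.cong)
    fix i assume "i \<in> {i. c i \<noteq> 0}"
    then have "i \<in> I" using c by auto
    then show "s2 (c i) (F (v i)) = s2 (c i) (G (v i))" using eq by simp
  qed simp
  also have "\<dots> = G x"
    by (subst x) (simp add: G.sum G.scale)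
  finally show ?thesis .
qed

lemma Klin_compose: "Klin s1 s2 f \<Longrightarrow> Klin s2 s3 g \<Longrightarrow> Klin s1 s3 (\<lambda>x. g (f x))"
  by (simp add: Klin_def)

lemma Klin_add: "module s2 \<Longrightarrow> Klin s1 s2 f \<Longrightarrow> Klin s1 s2 g \<Longrightarrow> Klin s1 s2 (\<lambda>x. f x + g x)"
  by (simp add: Klin_def module.scale_right_distrib)

lemma Klin_diff: "module s2 \<Longrightarrow> Klin s1 s2 f \<Longrightarrow> Klin s1 s2 g \<Longrightarrow> Klin s1 s2 (\<lambda>x. f x - g x)"
  by (simp add: Klin_def module.scale_right_diff_distrib)

lemma Klin_mult_left: "Kalg s2 \<Longrightarrow> Klin s1 s2 f \<Longrightarrow> Klin s1 s2 (\<lambda>x. a * f x)"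
  by (simp add: Klin_def Kalg_def distrib_left) metis

lemma Klin_mult_right: "Kalg s2 \<Longrightarrow> Klin s1 s2 f \<Longrightarrow> Klin s1 s2 (\<lambda>x. f x * a)"
  by (simp add: Klin_def Kalg_def distrib_right)

lemma Klin_zero: "module s2 \<Longrightarrow> Klin s1 s2 (\<lambda>x. 0)"
  by (simp add: Klin_def module.scale_zero_right)

lemma Klin_id: "Klin s s (\<lambda>x. x)"
  by (simp add: Klin_def)

definition multilinear where
  "multilinear smB s d F \<longleftrightarrow>
     (\<forall>xs ys x y. length xs + length ys + 1 = d \<longrightarrow>
        F (xs @ [x + y] @ ys) = F (xs @ [x] @ ys) + F (xs @ [y] @ ys)) \<and>
     (\<forall>xs ys a x. length xs + length ys + 1 = d \<longrightarrow>
        F (xs @ [smB a x] @ ys) = s a (F (xs @ [x] @ ys)))"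

lemma multilinear_Klin_slot:
  "multilinear smB s d F \<Longrightarrow> length xs + length ys + 1 = d \<Longrightarrow> Klin smB s (\<lambda>x. F (xs @ [x] @ ys))"
  by (auto simp: multilinear_def Klin_def)

lemma multilinearI:
  "(\<And>xs ys. length xs + length ys + 1 = d \<Longrightarrow> Klin smB s (\<lambda>x. F (xs @ [x] @ ys))) \<Longrightarrow>
    multilinear smB s d F"
  by (simp add: multilinear_def Klin_def)

lemma multilinear_compose:
  "multilinear smB s d F \<Longrightarrow> Klin s s' L \<Longrightarrow> multilinear smB s' d (\<lambda>xs. L (F xs))"
  by (simp add: multilinear_def Klin_def)

text \<open>Entries are freed from being basis vectors one at a time, from left to right: the
  induction is on an arbitrary prefix in front of a suffix of basis vectors.\<close>

lemma multilinear_eqI: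
  assumes mB: "module smB" and ms: "module s" and e: "is_basis_on smB UNIV e"
    and F: "multilinear smB s d F" and G: "multilinear smB s d G"
    and eq: "\<And>us. length us = d \<Longrightarrow> F (map e us) = G (map e us)"
    and len: "length xs = d"
  shows "F xs = G xs"
proof -
  have "F (xs @ map e us) = G (xs @ map e us)" if "length xs + length us = d" for xs us
    using that
  proof (induction xs arbitrary: us rule: rev_induct)
    case Nil
    then show ?case using eq by simp
  next
    case (snoc x xs)
    have l: "length xs + length (map e us) + 1 = d" using snoc.prems by simp
    have "(\<lambda>x. F (xs @ [x] @ map e us)) x = (\<lambda>x. G (xs @ [x] @ map e us)) x"
    proof (rule linear_eqI[OF mB ms e])
      fix u
      show "F (xs @ [e u] @ map e us) = G (xs @ [e u] @ map e us)"
        using snoc.IH[of "u # us"] snoc.prems by simp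
    qed (use multilinear_Klin_slot[OF F l] multilinear_Klin_slot[OF G l] in simp_all)
    then show ?case by simp
  qed
  from this[of xs "[]"] len show ?thesis by simp
qed

lemma tensorpow_multilinear: "is_tensorpow smB e d smd tpd \<Longrightarrow> multilinear smB smd d tpd"
  by (simp add: is_tensorpow_def multilinear_def)

section \<open>Tensor squares and tensor powers of the base algebra\<close>

locale tensors =
  fixes smB :: "'k::comm_ring_1 \<Rightarrow> 'b::ring_1 \<Rightarrow> 'b"
    and e :: "'j \<Rightarrow> 'b"
    and sm2 :: "'k \<Rightarrow> 'b2::ring_1 \<Rightarrow> 'b2" and tp2 :: "'b \<Rightarrow> 'b \<Rightarrow> 'b2"
    and smd :: "'k \<Rightarrow> 'bd::ring_1 \<Rightarrow> 'bd" and tpd :: "'b list \<Rightarrow> 'bd"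
    and d :: nat
  assumes d2: "d \<ge> 2"
    and B_alg: "Kalg smB"
    and B_free: "is_basis_on smB UNIV e"
    and T2: "is_tensor2 smB e sm2 tp2"
    and Td: "is_tensorpow smB e d smd tpd"
begin

lemma idx: "i \<in> {1..d-1} \<Longrightarrow> 1 \<le> i \<and> i < d"
  using d2 by auto

lemma mB: "module smB" using B_alg by (rule Kalg_module)
lemma alg2: "Kalg sm2" using T2 by (simp add: is_tensor2_def)
lemma algd: "Kalg smd" using Td by (simp add: is_tensorpow_def)
lemma m2: "module sm2" using alg2 by (rule Kalg_module)
lemma md: "module smd" using algd by (rule Kalg_module)

lemma tp2_Klin: "Klin smB sm2 (\<lambda>x. tp2 x y)" "Klin smB sm2 (tp2 x)"
  using T2 by (simp_all add: is_tensor2_def Klin_def)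

lemma tp2_mult: "tp2 x y * tp2 x' y' = tp2 (x * x') (y * y')" and tp2_one: "tp2 1 1 = 1"
  using T2 by (simp_all add: is_tensor2_def)

lemma tpd_mult: "length xs = d \<Longrightarrow> length ys = d \<Longrightarrow> tpd xs * tpd ys = tpd (map2 (*) xs ys)"
  and tpd_one: "tpd (replicate d 1) = 1"
  and tpd_basis: "is_basis_on smd {us. length us = d} (\<lambda>us. tpd (map e us))"
  using Td unfolding is_tensorpow_def by blast+

lemma tpd_multilinear: "multilinear smB smd d tpd"
  using Td by (rule tensorpow_multilinear)

lemma Td_eqI:
  assumes "module s" "Klin smd s F" "Klin smd s G"
    and "\<And>xs. length xs = d \<Longrightarrow> F (tpd xs) = G (tpd xs)"
  shows "F z = G z"
  by (rule linear_eqI[OF md assms(1) tpd_basis assms(2,3)]) (use assms(4) in simp)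

text \<open>\<open>opi\<close> is specified on lists split around one pair. Tensor factors
  \<open>i\<close> and \<open>i + 1\<close> are list positions \<open>i - 1\<close> and
  \<open>i\<close>, and every list of length \<open>d\<close> splits there.\<close>

lemma Td_eqI_pair:
  assumes "module s" "Klin smd s F" "Klin smd s G" and i: "i \<in> {1..d-1}"
    and eq: "\<And>xs ys x y. length xs = i - 1 \<Longrightarrow> length ys = d - i - 1 \<Longrightarrow>
           F (tpd (xs @ [x, y] @ ys)) = G (tpd (xs @ [x, y] @ ys))"
  shows "F z = G z"
proof (rule Td_eqI[OF assms(1-3)])
  fix zs :: "'b list" assume l: "length zs = d"
  have "drop (i - 1) zs = zs ! (i - 1) # zs ! i # drop (i + 1) zs"
    using i l Cons_nth_drop_Suc[of "i - 1" zs] Cons_nth_drop_Suc[of "i" zs] by auto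
  then have "zs = take (i - 1) zs @ [zs ! (i - 1), zs ! i] @ drop (i + 1) zs"
    by (metis append_Cons append_Nil append_take_drop_id)
  moreover have len: "length (take (i - 1) zs) = i - 1" "length (drop (i + 1) zs) = d - i - 1"
    using idx[OF i] l by auto
  ultimately show "F (tpd zs) = G (tpd zs)"
    using eq[OF len, of "zs ! (i - 1)" "zs ! i"] by simp
qed

lemma Td_extension:
  assumes "module s" "multilinear smB s d F"
  shows "\<exists>L. Klin smd s L \<and> (\<forall>xs. length xs = d \<longrightarrow> L (tpd xs) = F xs)"
proof -
  obtain L where L: "Klin smd s L" "\<And>us. length us = d \<Longrightarrow> L (tpd (map e us)) = F (map e us)"
    using linear_extension[OF md assms(1) tpd_basis, of "\<lambda>us. F (map e us)"] by auto
  have "L (tpd xs) = F xs" if "length xs = d" for xs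
    by (rule multilinear_eqI[OF mB assms(1) B_free multilinear_compose[OF tpd_multilinear L(1)] assms(2)])
      (use that L(2) in auto)
  with L(1) show ?thesis by blast
qed

lemma T2_basis: "is_basis_on sm2 UNIV (\<lambda>(j, l). tp2 (e j) (e l))"
  using T2 by (simp add: is_tensor2_def)

lemma T2_eqI:
  assumes "module s" "Klin sm2 s F" "Klin sm2 s G"
    and "\<And>x y. F (tp2 x y) = G (tp2 x y)"
  shows "F z = G z"
  by (rule linear_eqI[OF m2 assms(1) T2_basis assms(2,3)]) (use assms(4) in auto)

lemma T2_extension:
  assumes s: "module s" and F: "\<And>y. Klin smB s (\<lambda>x. F x y)" "\<And>x. Klin smB s (F x)"
  shows "\<exists>L. Klin sm2 s L \<and> (\<forall>x y. L (tp2 x y) = F x y)"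
proof -
  obtain L where L: "Klin sm2 s L" "\<And>j l. L (tp2 (e j) (e l)) = F (e j) (e l)"
    using linear_extension[OF m2 s T2_basis, of "\<lambda>(j,l). F (e j) (e l)"] by auto
  have 1: "L (tp2 x (e l)) = F x (e l)" for x l
    by (rule linear_eqI[OF mB s B_free Klin_compose[OF tp2_Klin(1) L(1)] F(1)]) (rule L(2))
  have "L (tp2 x y) = F x y" for x y
    by (rule linear_eqI[OF mB s B_free Klin_compose[OF tp2_Klin(2) L(1)] F(2)]) (rule 1)
  with L(1) show ?thesis by blast
qed

abbreviation "inst \<equiv> ins sm2 tp2 smd tpd"
abbreviation "emb \<equiv> embi sm2 tp2 smd tpd d"
abbreviation "op \<equiv> opi sm2 tp2 smd tpd d"

lemma tpd_slot: "length xs + length ys + 1 = d \<Longrightarrow> Klin smB smd (\<lambda>x. tpd (xs @ x # ys))"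
  using multilinear_Klin_slot[OF tpd_multilinear, of xs ys] by simp

text \<open>Discharges the \<open>THE\<close> in \<open>ins\<close>: bilinearity of two adjacent
  slots gives existence, and pure tensors spanning the tensor square gives uniqueness.\<close>

lemma ins_props:
  assumes "length xs + length ys + 2 = d"
  shows ins_Klin: "Klin sm2 smd (inst xs ys)"
    and ins_tp2: "inst xs ys (tp2 x y) = tpd (xs @ [x, y] @ ys)"
proof -
  let ?P = "\<lambda>L. Klin sm2 smd L \<and> (\<forall>x y. L (tp2 x y) = tpd (xs @ [x, y] @ ys))"
  have "\<exists>L. ?P L"
  proof (rule T2_extension[OF md])
    show "Klin smB smd (\<lambda>x. tpd (xs @ [x, y] @ ys))" for y
      using tpd_slot[of xs "y # ys"] assms by simp
    show "Klin smB smd (\<lambda>y. tpd (xs @ [x, y] @ ys))" for x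
      using tpd_slot[of "xs @ [x]" ys] assms by simp
  qed
  moreover have "L = L'" if "?P L" "?P L'" for L L'
  proof
    fix z show "L z = L' z" by (rule T2_eqI[OF md]) (use that in auto)
  qed
  ultimately have "\<exists>!L. ?P L" by blast
  from theI'[OF this] have "?P (inst xs ys)" unfolding ins_def[abs_def] by simp
  then show "Klin sm2 smd (inst xs ys)" "inst xs ys (tp2 x y) = tpd (xs @ [x, y] @ ys)" by auto
qed

lemma ins_mult:
  assumes "length xs + length ys + 2 = d" "length xs' = length xs" "length ys' = length ys"
  shows "inst xs ys Z * inst xs' ys' Z' = inst (map2 (*) xs xs') (map2 (*) ys ys') (Z * Z')"
proof -
  let ?m = "inst (map2 (*) xs xs') (map2 (*) ys ys')"
  have k: "Klin sm2 smd (inst xs ys)" "Klin sm2 smd (inst xs' ys')" "Klin sm2 smd ?m"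
    by (rule ins_Klin; use assms in simp)+
  have pure: "inst xs ys (tp2 x y) * inst xs' ys' (tp2 x' y') = ?m (tp2 x y * tp2 x' y')" for x y x' y'
    using assms by (simp add: ins_tp2 tp2_mult tpd_mult)
  have 1: "inst xs ys Z * inst xs' ys' (tp2 x' y') = ?m (Z * tp2 x' y')" for x' y'
    by (rule T2_eqI[OF md Klin_mult_right[OF algd k(1)]
          Klin_compose[OF Klin_mult_right[OF alg2 Klin_id] k(3)]]) (rule pure)
  show ?thesis
    by (rule T2_eqI[OF md Klin_mult_left[OF algd k(2)]
          Klin_compose[OF Klin_mult_left[OF alg2 Klin_id] k(3)]]) (rule 1)
qed

lemma emb_eq_ins: "emb i Z = inst (replicate (i - 1) 1) (replicate (d - i - 1) 1) Z"
  by (simp add: embi_def)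

lemma map2_replicate_one:
  "length xs = n \<Longrightarrow> map2 (*) (replicate n 1) xs = (xs :: 'b list)"
  "length xs = n \<Longrightarrow> map2 (*) xs (replicate n 1) = (xs :: 'b list)"
  by (auto intro: nth_equalityI)

lemma emb_mult_ins:
  assumes "i \<in> {1..d-1}" "length xs = i - 1" "length ys = d - i - 1"
  shows "emb i Z * inst xs ys Z' = inst xs ys (Z * Z')"
    and "inst xs ys Z' * emb i Z = inst xs ys (Z' * Z)"
  using assms by (auto simp: emb_eq_ins ins_mult map2_replicate_one)

lemma emb_Klin: "i \<in> {1..d-1} \<Longrightarrow> Klin sm2 smd (emb i)"
  using ins_Klin[of "replicate (i - 1) 1" "replicate (d - i - 1) 1"] idx[of i]
  by (simp add: embi_def[abs_def])

lemma emb_mult: "i \<in> {1..d-1} \<Longrightarrow> emb i (Z * Z') = emb i Z * emb i Z'"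
  using emb_mult_ins[of i "replicate (i - 1) 1" "replicate (d - i - 1) 1" Z Z']
  by (simp add: emb_eq_ins)

lemma emb_add: "i \<in> {1..d-1} \<Longrightarrow> emb i (Z + Z') = emb i Z + emb i Z'"
  using emb_Klin by (simp add: Klin_def)

lemma emb_diff: "i \<in> {1..d-1} \<Longrightarrow> emb i (Z - Z') = emb i Z - emb i Z'"
  using emb_add[of i "Z - Z'" Z'] by simp

lemma emb_one:
  assumes "i \<in> {1..d-1}" shows "emb i 1 = 1"
proof -
  have "replicate (i - 1) 1 @ [1, 1] @ replicate (d - i - 1) 1 = replicate d (1::'b)"
    using assms by (intro nth_equalityI) (auto simp: nth_append nth_Cons split: nat.splits)
  moreover have "length (replicate (i - 1) (1::'b)) + length (replicate (d - i - 1) (1::'b)) + 2 = d"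
    using idx[OF assms] by auto
  ultimately show ?thesis
    using ins_tp2[of "replicate (i - 1) 1" "replicate (d - i - 1) 1" 1 1]
    by (simp only: emb_eq_ins tp2_one tpd_one)
qed

text \<open>Multiplying the last $d-1$ tensor factors together splits the embedding into the first two
  factors, so no purity argument about $K \to B$ is needed.\<close>

lemma emb_1_inj: "emb 1 Z = emb 1 Z' \<Longrightarrow> Z = Z'"
proof -
  define F where "F xs = tp2 (hd xs) (prod_list (tl xs))" for xs
  have B: "smB a (x * y) = smB a x * y" "smB a (x * y) = x * smB a y" for a x y
    using B_alg unfolding Kalg_def by blast+
  have tp2: "tp2 (x + x') y = tp2 x y + tp2 x' y" "tp2 x (y + y') = tp2 x y + tp2 x y'"
      "tp2 (smB a x) y = sm2 a (tp2 x y)" "tp2 x (smB a y) = sm2 a (tp2 x y)" for a x x' y y'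
    using tp2_Klin by (simp_all add: Klin_def)
  have "multilinear smB sm2 d F"
    unfolding multilinear_def
  proof (intro conjI allI impI)
    fix xs ys :: "'b list" and x y a
    show "F (xs @ [x + y] @ ys) = F (xs @ [x] @ ys) + F (xs @ [y] @ ys)"
      by (cases xs) (simp_all add: F_def tp2 algebra_simps)
    show "F (xs @ [smB a x] @ ys) = sm2 a (F (xs @ [x] @ ys))"
      by (cases xs) (simp_all add: F_def tp2 flip: B)
  qed
  then obtain L where L: "Klin smd sm2 L" "\<And>xs. length xs = d \<Longrightarrow> L (tpd xs) = F xs"
    using Td_extension[OF m2] by blast
  have 1: "(1::nat) \<in> {1..d-1}" using d2 by simp
  have p: "prod_list (replicate n 1) = (1::'b)" for n by (induction n) auto
  have "L (emb 1 Z) = Z" for Z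
  proof (rule T2_eqI[OF m2 Klin_compose[OF emb_Klin[OF 1] L(1)] Klin_id])
    fix x y
    show "L (emb 1 (tp2 x y)) = tp2 x y"
      using d2 by (simp add: emb_eq_ins ins_tp2 L(2) F_def p)
  qed
  then show "emb 1 Z = emb 1 Z' \<Longrightarrow> Z = Z'" by metis
qed

text \<open>Linearity in the entries outside the distinguished pair; this is what makes the
  candidate for \<open>opi\<close> multilinear in those slots.\<close>

lemma ins_Klin_slot:
  assumes "length xs + length ys + length us + length vs + 3 = d"
  shows "Klin smB smd (\<lambda>x. inst (xs @ x # ys) (us @ vs) Z)"
    and "Klin smB smd (\<lambda>x. inst (xs @ ys) (us @ x # vs) Z)"
proof -
  have sc: "Klin sm2 smd (\<lambda>Z. smd a (inst xs' ys' Z))" if "length xs' + length ys' + 2 = d" for a xs' ys'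
    using ins_Klin[OF that] md
    by (simp add: Klin_def module.scale_right_distrib module.scale_left_commute)
  have slot: "Klin smB smd (\<lambda>x. tpd (xs @ x # ys @ y # z # us @ vs))"
     "Klin smB smd (\<lambda>x. tpd (xs @ ys @ y # z # us @ x # vs))" for y z
    using tpd_slot[of xs "ys @ y # z # us @ vs"] tpd_slot[of "xs @ ys @ y # z # us" vs] assms by simp_all
  have "inst (xs @ (x + y) # ys) (us @ vs) Z
      = inst (xs @ x # ys) (us @ vs) Z + inst (xs @ y # ys) (us @ vs) Z" for x y
    by (rule T2_eqI[OF md ins_Klin Klin_add[OF md ins_Klin ins_Klin]])
      (use assms slot in \<open>simp_all add: ins_tp2 Klin_def\<close>)
  moreover have "inst (xs @ smB a x # ys) (us @ vs) Z = smd a (inst (xs @ x # ys) (us @ vs) Z)" for a x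
    by (rule T2_eqI[OF md ins_Klin sc]) (use assms slot in \<open>simp_all add: ins_tp2 Klin_def\<close>)
  ultimately show "Klin smB smd (\<lambda>x. inst (xs @ x # ys) (us @ vs) Z)"
    by (simp add: Klin_def)
  have "inst (xs @ ys) (us @ (x + y) # vs) Z
      = inst (xs @ ys) (us @ x # vs) Z + inst (xs @ ys) (us @ y # vs) Z" for x y
    by (rule T2_eqI[OF md ins_Klin Klin_add[OF md ins_Klin ins_Klin]])
      (use assms slot in \<open>simp_all add: ins_tp2 Klin_def\<close>)
  moreover have "inst (xs @ ys) (us @ smB a x # vs) Z = smd a (inst (xs @ ys) (us @ x # vs) Z)" for a x
    by (rule T2_eqI[OF md ins_Klin sc]) (use assms slot in \<open>simp_all add: ins_tp2 Klin_def\<close>)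
  ultimately show "Klin smB smd (\<lambda>x. inst (xs @ ys) (us @ x # vs) Z)"
    by (simp add: Klin_def)
qed

lemma opi_props:
  assumes i: "i \<in> {1..d-1}" and phi: "Klin sm2 sm2 \<phi>"
  shows op_Klin: "Klin smd smd (op \<phi> i)"
    and op_ins: "length xs = i - 1 \<Longrightarrow> length ys = d - i - 1 \<Longrightarrow>
       op \<phi> i (inst xs ys Z) = inst xs ys (\<phi> Z)"
proof -
  let ?P = "\<lambda>F. Klin smd smd F \<and> (\<forall>xs ys x y. length xs = i - 1 \<and> length ys = d - i - 1 \<longrightarrow>
       F (tpd (xs @ [x, y] @ ys)) = inst xs ys (\<phi> (tp2 x y)))"
  define F where "F zs = inst (take (i - 1) zs) (drop (i + 1) zs) (\<phi> (tp2 (zs ! (i - 1)) (zs ! i)))" for zs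
  have "multilinear smB smd d F"
  proof (rule multilinearI)
    fix xs ys :: "'b list" assume l: "length xs + length ys + 1 = d"
    have k: "Klin smB smd (\<lambda>x. inst us vs (\<phi> (tp2 x y)))" "Klin smB smd (\<lambda>y. inst us vs (\<phi> (tp2 x y)))"
      if "length us + length vs + 2 = d" for us vs x y
      using Klin_compose[OF Klin_compose[OF tp2_Klin(1) phi] ins_Klin[OF that]]
        Klin_compose[OF Klin_compose[OF tp2_Klin(2) phi] ins_Klin[OF that]] by auto
    \<comment> \<open>The varying slot has list position \<open>length xs\<close>, while \<phi> acts
      at positions \<open>i - 1\<close> and \<open>i\<close>: before the pair, its first entry, its
      second entry, after it.\<close>
    consider (left) n where "i = length xs + Suc (Suc n)" | (fst) "i = Suc (length xs)"
      | (snd) "i = length xs" | (right) "length xs > i"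
    proof -
      have "i = length xs + Suc (Suc (i - length xs - 2)) \<or> i = Suc (length xs) \<or> i = length xs
          \<or> length xs > i" by linarith
      then show thesis using that by blast
    qed
    then show "Klin smB smd (\<lambda>x. F (xs @ [x] @ ys))"
    proof cases
      case left
      show ?thesis
      proof -
        have "length xs + length (take n ys) + length [] + length (drop (Suc (Suc n)) ys) + 3 = d"
          using left idx[OF i] l by auto
        from ins_Klin_slot(1)[OF this] show ?thesis
          using left by (simp add: F_def nth_append numeral_eq_Suc)
      qed
    next
      case fst
      then show ?thesis
        using k(1)[of xs "drop 1 ys" "ys ! 0"] idx[OF i] l by (simp add: F_def nth_append)
    next
      case snd
      then have "length (take (i - 1) xs) + length ys + 2 = d" "i - 1 < length xs"
        using idx[OF i] l by auto
      then show ?thesis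
        using k(2)[of "take (i - 1) xs" ys "xs ! (i - 1)"] snd by (simp add: F_def nth_append)
    next
      case right
      then show ?thesis
        using ins_Klin_slot(2)[of "take (i - 1) xs" "[]" "drop (i + 1) xs" ys] idx[OF i] l
          less_trans[of "i - 1" i "length xs"]
        by (simp add: F_def nth_append)
    qed
  qed
  then obtain L where L: "Klin smd smd L" "\<And>xs. length xs = d \<Longrightarrow> L (tpd xs) = F xs"
    using Td_extension[OF md] by blast
  have "?P L"
    using i L by (auto simp: F_def nth_append Suc_diff_le)
  moreover have "L = L'" if "?P L" "?P L'" for L L'
  proof
    fix z show "L z = L' z" by (rule Td_eqI_pair[OF md _ _ i]) (use that in auto)
  qed
  ultimately have "\<exists>!L. ?P L" by blast
  from theI'[OF this] have P: "?P (op \<phi> i)" unfolding opi_def[abs_def] by simp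
  then show k: "Klin smd smd (op \<phi> i)" by simp
  assume l: "length xs = i - 1" "length ys = d - i - 1"
  then have l': "length xs + length ys + 2 = d" using i by auto
  show "op \<phi> i (inst xs ys Z) = inst xs ys (\<phi> Z)"
    by (rule T2_eqI[OF md Klin_compose[OF ins_Klin[OF l'] k] Klin_compose[OF phi ins_Klin[OF l']]])
      (use P l l' in \<open>simp add: ins_tp2\<close>)
qed

lemma op_emb: "i \<in> {1..d-1} \<Longrightarrow> Klin sm2 sm2 \<phi> \<Longrightarrow> op \<phi> i (emb i Z) = emb i (\<phi> Z)"
  by (simp add: emb_eq_ins op_ins)

lemma split_far:
  assumes "i \<in> {1..d-1}" "j \<in> {1..d-1}" "i + 2 \<le> j \<or> j + 2 \<le> i"
  obtains us vs where "length us = i - 1" "length vs = d - i - 1"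
    "replicate (j - 1) 1 @ [x, y] @ replicate (d - j - 1) 1 = us @ [1, 1] @ (vs :: 'b list)"
proof -
  let ?zs = "replicate (j - 1) 1 @ [x, y] @ replicate (d - j - 1) 1"
  have l: "length ?zs = d" using assms by auto
  have n: "?zs ! (i - 1) = 1" "?zs ! i = 1"
    using assms by (auto simp: nth_append nth_Cons split: nat.splits)
  have "drop (i - 1) ?zs = ?zs ! (i - 1) # ?zs ! i # drop (i + 1) ?zs"
    using assms l Cons_nth_drop_Suc[of "i - 1" ?zs] Cons_nth_drop_Suc[of "i" ?zs] by auto
  then have "?zs = take (i - 1) ?zs @ [1, 1] @ drop (i + 1) ?zs"
    unfolding n by (metis append_Cons append_Nil append_take_drop_id)
  moreover have "length (take (i - 1) ?zs) = i - 1" "length (drop (i + 1) ?zs) = d - i - 1"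
    using assms l by auto
  ultimately show ?thesis using that by blast
qed

text \<open>For distant \<open>i\<close> and \<open>j\<close>, factors \<open>i\<close> and
  \<open>i + 1\<close> of each pure tensor in \<open>emb j Z\<close> are both 1, so \<phi> is only
  evaluated at 1. The two cases serve \<sigma> and \<rho>.\<close>

lemma op_emb_far:
  assumes "i \<in> {1..d-1}" "j \<in> {1..d-1}" "i + 2 \<le> j \<or> j + 2 \<le> i" and phi: "Klin sm2 sm2 \<phi>"
  shows "\<phi> 1 = 1 \<Longrightarrow> op \<phi> i (emb j Z) = emb j Z"
    and "\<phi> 1 = 0 \<Longrightarrow> op \<phi> i (emb j Z) = 0"
proof -
  have e: "emb j (tp2 x y) = tpd (replicate (j - 1) 1 @ [x, y] @ replicate (d - j - 1) 1)" for x y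
    unfolding emb_eq_ins by (rule ins_tp2) (use assms in auto)
  have p: "\<exists>us vs. length us + length vs + 2 = d \<and> emb j (tp2 x y) = inst us vs 1 \<and>
      op \<phi> i (emb j (tp2 x y)) = inst us vs (\<phi> 1)" for x y
  proof -
    obtain us vs where l: "length us = i - 1" "length vs = d - i - 1"
      and eq: "replicate (j - 1) 1 @ [x, y] @ replicate (d - j - 1) 1 = us @ [1, 1] @ vs"
      using split_far[OF assms(1-3)] by blast
    have l': "length us + length vs + 2 = d" using l assms(1) by auto
    have "emb j (tp2 x y) = inst us vs 1"
      unfolding e eq using ins_tp2[OF l', of 1 1] by (simp add: tp2_one)
    moreover have "op \<phi> i (inst us vs 1) = inst us vs (\<phi> 1)"
      by (rule op_ins[OF assms(1) phi l])
    ultimately show ?thesis using l' by metis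
  qed
  note k = Klin_compose[OF emb_Klin[OF assms(2)] op_Klin[OF assms(1) phi]]
  show "op \<phi> i (emb j Z) = emb j Z" if "\<phi> 1 = 1"
    by (rule T2_eqI[OF md k emb_Klin[OF assms(2)]]) (metis p that)
  show "op \<phi> i (emb j Z) = 0" if "\<phi> 1 = 0"
  proof (rule T2_eqI[OF md k Klin_zero[OF md]])
    fix x y
    obtain us vs where "length us + length vs + 2 = d" "op \<phi> i (emb j (tp2 x y)) = inst us vs (\<phi> 1)"
      using p by blast
    then show "op \<phi> i (emb j (tp2 x y)) = 0"
      using ins_Klin[of us vs] that unfolding Klin_def by (metis add_cancel_right_right)
  qed
qed

lemma emb_commute_far:
  assumes "i \<in> {1..d-1}" "j \<in> {1..d-1}" "i + 2 \<le> j \<or> j + 2 \<le> i"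
  shows "emb i Z * emb j Z' = emb j Z' * emb i Z"
proof -
  have "emb i Z * emb j (tp2 x y) = emb j (tp2 x y) * emb i Z" for x y
  proof -
    obtain us vs where l: "length us = i - 1" "length vs = d - i - 1"
      and eq: "replicate (j - 1) 1 @ [x, y] @ replicate (d - j - 1) 1 = us @ [1, 1] @ vs"
      using split_far[OF assms(1-3)] by blast
    have l': "length us + length vs + 2 = d" using l assms(1) by auto
    have "emb j (tp2 x y) = tpd (replicate (j - 1) 1 @ [x, y] @ replicate (d - j - 1) 1)"
      unfolding emb_eq_ins by (rule ins_tp2) (use assms in auto)
    then have "emb j (tp2 x y) = inst us vs 1"
      unfolding eq using ins_tp2[OF l', of 1 1] by (simp add: tp2_one)
    then show ?thesis using emb_mult_ins[OF assms(1) l] by simp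
  qed
  then show ?thesis
    by (rule T2_eqI[OF md Klin_mult_left[OF algd emb_Klin[OF assms(2)]]
          Klin_mult_right[OF algd emb_Klin[OF assms(2)]]])
qed

lemma tpd_eq_ins: "length xs + length ys + 2 = d \<Longrightarrow> tpd (xs @ [x, y] @ ys) = inst xs ys (tp2 x y)"
  by (simp add: ins_tp2)

section \<open>Factorwise extension of an algebra endomorphism; applied to \<open>hsh\<close> and to
  its inverse\<close>

abbreviation "hash \<equiv> hashd smd tpd d"
abbreviation "hash' \<equiv> hash2 sm2 tp2"

context
  fixes k :: "'b \<Rightarrow> 'b"
  assumes k: "Kalg_hom smB smB k"
begin

lemma k_simps: "k (x + y) = k x + k y" "k (x * y) = k x * k y" "k 1 = 1" "k (smB a x) = smB a (k x)"
  using k by (simp_all add: Kalg_hom_def Klin_def)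

lemma hash2_Klin: "Klin sm2 sm2 (hash' k)" and hash2_tp2: "hash' k (tp2 x y) = tp2 (k x) (k y)"
proof -
  let ?P = "\<lambda>F. Klin sm2 sm2 F \<and> (\<forall>x y. F (tp2 x y) = tp2 (k x) (k y))"
  have kl: "Klin smB smB k" using k by (simp add: Kalg_hom_def)
  have "\<exists>F. ?P F"
    by (rule T2_extension[OF m2])
      (use Klin_compose[OF kl tp2_Klin(1)] Klin_compose[OF kl tp2_Klin(2)] in auto)
  moreover have "F = F'" if "?P F" "?P F'" for F F'
  proof
    fix z show "F z = F' z" by (rule T2_eqI[OF m2]) (use that in auto)
  qed
  ultimately have "\<exists>!F. ?P F" by blast
  from theI'[OF this] have "?P (hash' k)" unfolding hash2_def by simp
  then show "Klin sm2 sm2 (hash' k)" "hash' k (tp2 x y) = tp2 (k x) (k y)" by auto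
qed

lemma hashd_Klin: "Klin smd smd (hash k)"
  and hashd_tpd: "length xs = d \<Longrightarrow> hash k (tpd xs) = tpd (map k xs)"
proof -
  let ?P = "\<lambda>F. Klin smd smd F \<and> (\<forall>xs. length xs = d \<longrightarrow> F (tpd xs) = tpd (map k xs))"
  have "multilinear smB smd d (\<lambda>xs. tpd (map k xs))"
    using tpd_multilinear unfolding multilinear_def by (simp add: k_simps)
  then have "\<exists>F. ?P F"
    by (rule Td_extension[OF md])
  moreover have "F = F'" if "?P F" "?P F'" for F F'
  proof
    fix z show "F z = F' z" by (rule Td_eqI[OF md]) (use that in auto)
  qed
  ultimately have "\<exists>!F. ?P F" by blast
  from theI'[OF this] have "?P (hash k)" unfolding hashd_def by simp
  then show "Klin smd smd (hash k)" "length xs = d \<Longrightarrow> hash k (tpd xs) = tpd (map k xs)" by auto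
qed

lemma hashd_ins:
  assumes "length xs + length ys + 2 = d"
  shows "hash k (inst xs ys Z) = inst (map k xs) (map k ys) (hash' k Z)"
proof (rule T2_eqI[OF md Klin_compose[OF ins_Klin hashd_Klin] Klin_compose[OF hash2_Klin ins_Klin]])
  show "hash k (inst xs ys (tp2 x y)) = inst (map k xs) (map k ys) (hash' k (tp2 x y))" for x y
    using assms by (simp add: ins_tp2 hash2_tp2 hashd_tpd)
qed (use assms in auto)

lemma hashd_emb: "i \<in> {1..d-1} \<Longrightarrow> hash k (emb i Z) = emb i (hash' k Z)"
  using hashd_ins[of "replicate (i - 1) 1" "replicate (d - i - 1) 1" Z] idx[of i]
  by (simp add: emb_eq_ins map_replicate k_simps)

lemma hashd_one: "hash k 1 = 1"
  using hashd_tpd[of "replicate d 1"] by (simp add: tpd_one k_simps map_replicate)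

lemma hashd_mult: "hash k (a * b) = hash k a * hash k b"
proof -
  have pure: "hash k (tpd xs * tpd ys) = hash k (tpd xs) * hash k (tpd ys)"
    if "length xs = d" "length ys = d" for xs ys
  proof -
    have "map k (map2 (*) xs ys) = map2 (*) (map k xs) (map k ys)"
      using that by (intro nth_equalityI) (simp_all add: k_simps)
    then show ?thesis using that by (simp add: tpd_mult hashd_tpd)
  qed
  have 1: "hash k (a * tpd ys) = hash k a * hash k (tpd ys)" if "length ys = d" for ys
    by (rule Td_eqI[OF md Klin_compose[OF Klin_mult_right[OF algd Klin_id] hashd_Klin]
          Klin_mult_right[OF algd hashd_Klin]]) (rule pure[OF _ that])
  show ?thesis
    by (rule Td_eqI[OF md Klin_compose[OF Klin_mult_left[OF algd Klin_id] hashd_Klin]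
          Klin_mult_left[OF algd hashd_Klin]]) (rule 1)
qed

lemma hashd_alg_hom: "Kalg_hom smd smd (hash k)"
  using hashd_Klin hashd_mult hashd_one by (simp add: Kalg_hom_def)

end

lemma hashd_inverse:
  assumes "Kalg_hom smB smB k" "Kalg_hom smB smB k'" "\<And>x. k (k' x) = x"
  shows "hash k (hash k' z) = z"
proof (rule Td_eqI[OF md Klin_compose[OF hashd_Klin hashd_Klin] Klin_id])
  show "hash k (hash k' (tpd xs)) = tpd xs" if "length xs = d" for xs
    using that by (simp add: hashd_tpd[OF assms(1)] hashd_tpd[OF assms(2)] assms(3) comp_def)
qed (use assms in auto)

end

lemma Kalg_hom_inv:
  assumes h: "Kalg_hom sm1 sm2 h" and b: "bij h"
  shows "Kalg_hom sm2 sm1 (inv h)"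
proof -
  have e: "inv h x = y \<longleftrightarrow> x = h y" for x y
    using b by (metis bij_inv_eq_iff)
  have "h (inv h x) = x" for x using b by (simp add: bij_is_surj surj_f_inv_f)
  then show ?thesis
    using h unfolding Kalg_hom_def Klin_def e by metis
qed

section \<open>Reduced words of short permutations\<close>

lemma word_perm_append: "word_perm (xs @ ys) = word_perm xs \<circ> word_perm ys"
  by (induction xs) (simp_all add: comp_assoc)

lemma word_perm_permutes: "set is \<subseteq> {1..<d} \<Longrightarrow> word_perm is permutes {1..d}"
proof (induction "is")
  case (Cons i "is")
  have "transpose i (Suc i) permutes {1..d}"
    by (rule permutes_swap_id) (use Cons.prems in auto)
  then have "transpose i (Suc i) \<circ> word_perm is permutes {1..d}"
    by (rule permutes_compose[rotated]) (use Cons in simp)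
  then show ?case unfolding word_perm.simps .
qed (simp add: permutes_id)

text \<open>Conjugating the transposition of \<open>a\<close> and \<open>a + n\<close> by the simple
  one at \<open>a + n\<close> moves its upper end up by one.\<close>

lemma word_perm_transpose:
  assumes "1 \<le> a" "a + n \<le> d"
  shows "\<exists>is. set is \<subseteq> {1..<d} \<and> word_perm is = transpose a (a + n)"
  using assms
proof (induction n)
  case 0
  show ?case by (rule exI[of _ "[]"]) simp
next
  case (Suc n)
  then obtain "is" where "is": "set is \<subseteq> {1..<d}" "word_perm is = transpose a (a + n)" by auto
  show ?case
  \<comment> \<open>For \<open>n = 0\<close> the inner factor is the identity and conjugation would
    return the identity, so a single letter is used.\<close>
  proof (cases "n = 0")
    case True
    then have "set [a] \<subseteq> {1..<d} \<and> word_perm [a] = transpose a (a + Suc n)" using Suc.prems by auto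
    then show ?thesis by blast
  next
    case False
    have "word_perm ([a + n] @ is @ [a + n]) = transpose a (a + Suc n)"
      using False by (simp add: word_perm_append "is" fun_eq_iff) (auto simp: transpose_def)
    moreover have "set ([a + n] @ is @ [a + n]) \<subseteq> {1..<d}" using "is" Suc.prems by auto
    ultimately show ?thesis by blast
  qed
qed

lemma permutes_word_perm:
  assumes "w permutes {1..d}"
  shows "\<exists>is. set is \<subseteq> {1..<d} \<and> word_perm is = w"
  using finite_atLeastAtMost assms
proof (induction rule: permutes_rev_induct)
  case id
  show ?case by (rule exI[of _ "[]"]) simp
next
  case (swap a b p)
  then obtain "is" where "is": "set is \<subseteq> {1..<d}" "word_perm is = p" by auto
  have "\<exists>js. set js \<subseteq> {1..<d} \<and> word_perm js = transpose a b"
    using word_perm_transpose[of a "b - a" d] word_perm_transpose[of b "a - b" d] swap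
    by (cases "a \<le> b") (auto simp: transpose_commute)
  then obtain js where "set js \<subseteq> {1..<d}" "word_perm js = transpose a b" by auto
  with "is" have "set (is @ js) \<subseteq> {1..<d} \<and> word_perm (is @ js) = p \<circ> transpose a b"
    by (simp add: word_perm_append)
  then show ?case by blast
qed

lemma reduced_word_exists:
  assumes "w permutes {1..d}"
  shows "\<exists>is. reduced_word d w is"
proof -
  obtain "is" where "is": "set is \<subseteq> {1..<d} \<and> word_perm is = w"
    using permutes_word_perm[OF assms] by blast
  from ex_has_least_nat[of "\<lambda>is. set is \<subseteq> {1..<d} \<and> word_perm is = w", OF this, of length]
  show ?thesis unfolding reduced_word_def by blast
qed

lemma Hw_word:
  assumes w: "w permutes {1..d}"
  obtains "is" where "set is \<subseteq> {1..<d}" "Hw d H w = Hprod H is"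
  using someI_ex[OF reduced_word_exists[OF w]] that unfolding Hw_def reduced_word_def by blast

text \<open>\<open>Hw\<close> picks a reduced word by \<open>SOME\<close>, known only to be no
  longer than \<open>is\<close>. Agreement of the products over all such words settles the
  choice.\<close>

lemma Hw_eq_Hprod:
  assumes "is": "set is \<subseteq> {1..<d}"
    and uniq: "\<And>js. word_perm js = word_perm is \<Longrightarrow> length js \<le> length is \<Longrightarrow> Hprod H js = Hprod H is"
  shows "Hw d H (word_perm is) = Hprod H is"
proof -
  have "reduced_word d (word_perm is) (SOME js. reduced_word d (word_perm is) js)"
    using someI_ex[OF reduced_word_exists[OF word_perm_permutes[OF "is"]]] .
  then show ?thesis unfolding Hw_def using uniq "is" unfolding reduced_word_def by blast
qed

text \<open>Used to follow single points through a word: a letter shifts a point by at most one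
  place, and a proper shift reveals the letter.\<close>

lemma transpose_Suc_step:
  assumes "transpose k (Suc k) x = y"
  shows "y \<le> Suc x" "x \<le> Suc y" "y = Suc x \<Longrightarrow> k = x" "x = Suc y \<Longrightarrow> k = y"
proof -
  have c: "x = k \<and> y = Suc k \<or> x = Suc k \<and> y = k \<or> y = x"
  proof -
    consider "x = k" | "x = Suc k" | "x \<noteq> k" "x \<noteq> Suc k" by blast
    then show ?thesis
    proof cases
      case 1
      then show ?thesis using assms by simp
    next
      case 2
      then show ?thesis using assms by simp
    next
      case 3
      then have "transpose k (Suc k) x = x" by (rule transpose_apply_other)
      then show ?thesis using assms by simp
    qed
  qed
  show "y \<le> Suc x" using c by auto
  show "x \<le> Suc y" using c by auto
  show "k = x" if "y = Suc x" using c that by auto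
  show "k = y" if "x = Suc y" using c that by auto
qed

lemma short_list_cases:
  assumes "length js \<le> 3"
  obtains "js = []" | k where "js = [k]" | k l where "js = [k, l]" | k l m where "js = [k, l, m]"
proof -
  have "length js = 0 \<or> length js = Suc 0 \<or> length js = Suc (Suc 0) \<or> length js = Suc (Suc (Suc 0))"
    using assms by linarith
  then show thesis using that unfolding length_0_conv length_Suc_conv by blast
qed

lemma word_perm_eq_simple:
  assumes "word_perm js = word_perm [i]" "length js \<le> 1"
  shows "js = [i]"
proof -
  have v: "word_perm js i = Suc i" using assms by simp
  have "length js \<le> 3" using assms by simp
  then show ?thesis
  proof (cases rule: short_list_cases)
    case (2 k)
    have "transpose k (Suc k) i = Suc i" using v 2 by simp
    from transpose_Suc_step(3)[OF this refl] show ?thesis using 2 by simp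
  qed (use v assms(2) in simp_all)
qed

lemma word_perm_eq_two:
  assumes "word_perm js = word_perm [i, j]" "j = Suc i \<or> i = Suc j" "length js \<le> 2"
  shows "js = [i, j]"
proof -
  \<comment> \<open>\<open>x\<close> is the point that the product moves by two places, to
    \<open>y\<close>. Two letters can achieve this only if both move it, which determines
    them.\<close>
  define x where "x = (if j = Suc i then Suc j else j)"
  define y where "y = (if j = Suc i then i else Suc i)"
  have v: "word_perm js x = y"
    using assms(2) by (auto simp: assms(1) x_def y_def transpose_def)
  have xy: "x = Suc (Suc y) \<and> i = y \<and> j = Suc y \<or> y = Suc (Suc x) \<and> i = Suc x \<and> j = x"
    using assms(2) by (auto simp: x_def y_def)
  have "length js \<le> 3" using assms by simp
  then show ?thesis
  proof (cases rule: short_list_cases)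
    case 1
    then show ?thesis using v xy by auto
  next
    case (2 k)
    have "transpose k (Suc k) x = y" using v 2 by simp
    from transpose_Suc_step(1,2)[OF this] show ?thesis using xy by auto
  next
    case (3 k l)
    obtain a where a: "transpose l (Suc l) x = a" by simp
    have b: "transpose k (Suc k) a = y" using v 3 a by simp
    note st = transpose_Suc_step[OF a] transpose_Suc_step[OF b]
    from xy have "k = i \<and> l = j"
    proof
      assume up: "x = Suc (Suc y) \<and> i = y \<and> j = Suc y"
      with st(2,6) have "a = Suc y" by linarith
      with up st(4,8) show ?thesis by simp
    next
      assume down: "y = Suc (Suc x) \<and> i = Suc x \<and> j = x"
      with st(1,5) have "a = Suc x" by linarith
      with down st(3,7) show ?thesis by simp
    qed
    then show ?thesis using 3 by simp
  qed (use assms(3) in simp)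
qed

text \<open>The word has to carry $i$ up by two and $i+2$ down by two.\<close>

lemma word_perm_eq_three:
  assumes "word_perm js = word_perm [i, Suc i, i]" "length js \<le> 3"
  shows "js = [i, Suc i, i] \<or> js = [Suc i, i, Suc i]"
proof -
  have v: "word_perm js i = Suc (Suc i)" "word_perm js (Suc (Suc i)) = i"
    by (simp_all add: assms(1) transpose_def)
  show ?thesis using assms(2)
  proof (cases rule: short_list_cases)
    case 1
    then show ?thesis using v by simp
  next
    case (2 k)
    have "transpose k (Suc k) i = Suc (Suc i)" using v 2 by simp
    from transpose_Suc_step(1)[OF this] show ?thesis by simp
  next
    case (3 k l)
    obtain a where a: "transpose l (Suc l) i = a" by simp
    have b: "transpose k (Suc k) a = Suc (Suc i)" using v 3 a by simp
    obtain c where c: "transpose l (Suc l) (Suc (Suc i)) = c" by simp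
    have e: "transpose k (Suc k) c = i" using v 3 c by simp
    have "a = Suc i" using transpose_Suc_step(1)[OF a] transpose_Suc_step(1)[OF b] by linarith
    moreover have "c = Suc i" using transpose_Suc_step(2)[OF c] transpose_Suc_step(2)[OF e] by linarith
    ultimately have "l = i" "l = Suc i"
      using transpose_Suc_step(3)[OF a] transpose_Suc_step(4)[OF c] by simp_all
    then show ?thesis by simp
  next
    case (4 k l m)
    obtain a b where a: "transpose m (Suc m) i = a" and b: "transpose l (Suc l) a = b" by simp
    have c: "transpose k (Suc k) b = Suc (Suc i)" using v 4 a b by simp
    obtain a' b' where a': "transpose m (Suc m) (Suc (Suc i)) = a'" and b': "transpose l (Suc l) a' = b'"
      by simp
    have c': "transpose k (Suc k) b' = i" using v 4 a' b' by simp
    have "a \<le> Suc i" "b \<le> Suc a" "Suc i \<le> b"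
      using transpose_Suc_step(1)[OF a] transpose_Suc_step(1)[OF b] transpose_Suc_step(1)[OF c] by simp_all
    \<comment> \<open>Rising by two in three steps leaves one step idle, hence three cases, and
      likewise for the descent; the two lists are compatible only for the two claimed words.\<close>
    then have "a = i \<and> b = Suc i \<or> a = Suc i \<and> b = Suc i \<or> a = Suc i \<and> b = Suc (Suc i)"
      by linarith
    then have up: "l = i \<and> k = Suc i \<or> m = i \<and> k = Suc i \<or> m = i \<and> l = Suc i"
      using transpose_Suc_step(3)[OF a] transpose_Suc_step(3)[OF b] transpose_Suc_step(3)[OF c] by auto
    have "Suc i \<le> a'" "a' \<le> Suc b'" "b' \<le> Suc i"
      using transpose_Suc_step(2)[OF a'] transpose_Suc_step(2)[OF b'] transpose_Suc_step(2)[OF c'] by simp_all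
    then have "a' = Suc (Suc i) \<and> b' = Suc i \<or> a' = Suc i \<and> b' = Suc i \<or> a' = Suc i \<and> b' = i"
      by linarith
    then have "l = Suc i \<and> k = i \<or> m = Suc i \<and> k = i \<or> m = Suc i \<and> l = i"
      using transpose_Suc_step(4)[OF a'] transpose_Suc_step(4)[OF b'] transpose_Suc_step(4)[OF c'] by auto
    with up show ?thesis using 4 by auto
  qed
qed

lemma Hw_id: "Hw d H id = 1"
proof -
  have "Hw d H (word_perm []) = Hprod H []"
    by (rule Hw_eq_Hprod) auto
  then show ?thesis by simp
qed

lemma Hw_simple:
  assumes "i \<in> {1..<d}"
  shows "Hw d H (word_perm [i]) = H i"
proof -
  have "Hw d H (word_perm [i]) = Hprod H [i]"
  proof (rule Hw_eq_Hprod)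
    fix js assume "word_perm js = word_perm [i]" "length js \<le> length [i]"
    then have "js = [i]" using word_perm_eq_simple[of js i] by simp
    then show "Hprod H js = Hprod H [i]" by simp
  qed (use assms in simp)
  then show ?thesis by simp
qed

lemma Hw_two:
  assumes "i \<in> {1..<d}" "j \<in> {1..<d}" "j = Suc i \<or> i = Suc j"
  shows "Hw d H (word_perm [i, j]) = H i * H j"
proof -
  have "Hw d H (word_perm [i, j]) = Hprod H [i, j]"
  proof (rule Hw_eq_Hprod)
    fix js assume "word_perm js = word_perm [i, j]" "length js \<le> length [i, j]"
    then have "js = [i, j]" using word_perm_eq_two[of js i j] assms(3) by simp
    then show "Hprod H js = Hprod H [i, j]" by simp
  qed (use assms in simp)
  then show ?thesis by simp
qed

lemma Hw_three:
  assumes "i \<in> {1..<d}" "Suc i \<in> {1..<d}" and braid: "H i * H (Suc i) * H i = H (Suc i) * H i * H (Suc i)"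
  shows "Hw d H (word_perm [i, Suc i, i]) = H i * H (Suc i) * H i"
proof -
  have "Hw d H (word_perm [i, Suc i, i]) = Hprod H [i, Suc i, i]"
  proof (rule Hw_eq_Hprod)
    fix js assume "word_perm js = word_perm [i, Suc i, i]" "length js \<le> length [i, Suc i, i]"
    then have "js = [i, Suc i, i] \<or> js = [Suc i, i, Suc i]"
      using word_perm_eq_three[of js i] by simp
    then show "Hprod H js = Hprod H [i, Suc i, i]" using braid by (auto simp: mult.assoc)
  qed (use assms in simp)
  then show ?thesis by (simp add: mult.assoc)
qed

lemma word_perms_distinct:
  "distinct [id, word_perm [i], word_perm [Suc i], word_perm [i, Suc i], word_perm [Suc i, i],
     word_perm [i, Suc i, i]]"
proof -
  \<comment> \<open>The images of \<open>i\<close> and \<open>Suc i\<close> already separate the six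
    permutations.\<close>
  have "distinct (map (\<lambda>w. (w i, w (Suc i))) [id, word_perm [i], word_perm [Suc i],
     word_perm [i, Suc i], word_perm [Suc i, i], word_perm [i, Suc i, i]])"
    by (simp add: transpose_def)
  then show ?thesis by (rule distinct_map[THEN iffD1, THEN conjunct1])
qed

section \<open>The quantum wreath product\<close>

locale qwreath = tensors smB e sm2 tp2 smd tpd d
  for smB :: "'k::comm_ring_1 \<Rightarrow> 'b::ring_1 \<Rightarrow> 'b"
    and e :: "'j \<Rightarrow> 'b"
    and sm2 :: "'k \<Rightarrow> 'b2::ring_1 \<Rightarrow> 'b2" and tp2 :: "'b \<Rightarrow> 'b \<Rightarrow> 'b2"
    and smd :: "'k \<Rightarrow> 'bd::ring_1 \<Rightarrow> 'bd" and tpd :: "'b list \<Rightarrow> 'bd"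
    and d :: nat +
  fixes S R :: 'b2 and \<sigma> \<rho> :: "'b2 \<Rightarrow> 'b2"
    and smW :: "'k \<Rightarrow> 'w::ring_1 \<Rightarrow> 'w" and \<iota> :: "'bd \<Rightarrow> 'w" and H :: "nat \<Rightarrow> 'w"
  assumes sigma_lin: "Klin sm2 sm2 \<sigma>" and rho_lin: "Klin sm2 sm2 \<rho>"
    and W: "is_qwreath smB e sm2 tp2 smd tpd d S R \<sigma> \<rho> smW \<iota> H"
begin

abbreviation "relations \<equiv> qw_relations sm2 tp2 smd tpd d S R \<sigma> \<rho>"

lemmas W_unfolded = W[unfolded is_qwreath_def]
lemmas algW = W_unfolded[THEN conjunct1]
lemmas \<iota>_hom = W_unfolded[THEN conjunct2, THEN conjunct1]
lemmas relations_W = W_unfolded[THEN conjunct2, THEN conjunct2, THEN conjunct1]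
lemmas universal = W_unfolded[THEN conjunct2, THEN conjunct2, THEN conjunct2, THEN conjunct1, rule_format]
lemmas PBW = W_unfolded[THEN conjunct2, THEN conjunct2, THEN conjunct2, THEN conjunct2]

lemma mW: "module smW" using algW by (rule Kalg_module)

lemma relations_gen:
  assumes "i \<in> {1..d-1}"
  shows H_quad: "H i * H i = \<iota> (emb i S) * H i + \<iota> (emb i R)"
    and H_wreath: "H i * \<iota> b = \<iota> (op \<sigma> i b) * H i + \<iota> (op \<rho> i b)"
  using relations_W assms unfolding qw_relations_def by blast+

lemma H_braid: "1 \<le> i \<Longrightarrow> Suc i < d \<Longrightarrow> H i * H (Suc i) * H i = H (Suc i) * H i * H (Suc i)"
  using relations_W unfolding qw_relations_def by auto

lemma H_commute_far:
  "i \<in> {1..d-1} \<Longrightarrow> j \<in> {1..d-1} \<Longrightarrow> i + 2 \<le> j \<or> j + 2 \<le> i \<Longrightarrow> H i * H j = H j * H i"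
  using relations_W unfolding qw_relations_def by blast

sublocale ring_emb \<iota>
  by unfold_locales (use \<iota>_hom in \<open>simp_all add: Kalg_hom_def Klin_def\<close>)

text \<open>The basis assumption concerns scalar coefficients indexed by pairs. Expanding each
  \<open>b w\<close> in the tensor basis turns a relation over the tensor power into a scalar
  one.\<close>

lemma PBW_independent:
  assumes F: "finite F" "\<And>w. w \<in> F \<Longrightarrow> w permutes {1..d}"
    and zero: "(\<Sum>w\<in>F. \<iota> (b w) * Hw d H w) = 0" and w: "w \<in> F"
  shows "b w = 0"
proof -
  interpret W: module smW by (rule mW)
  interpret D: module smd by (rule md)
  define rep0 where "rep0 x c \<longleftrightarrow> (\<forall>us. us \<notin> {us. length us = d} \<longrightarrow> c us = 0) \<and> finite {us. c us \<noteq> 0} \<and>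
      x = (\<Sum>us\<in>{us. c us \<noteq> 0}. smd (c us) (tpd (map e us)))" for x c
  have "\<exists>c. rep0 x c" for x
    using spec[OF tpd_basis[unfolded is_basis_on_def], of x] unfolding rep0_def by (rule ex1_implies_ex)
  then obtain c where "rep0 x (c x)" for x by metis
  note c = this[unfolded rep0_def]
  have c_len: "length us \<noteq> d \<Longrightarrow> c x us = 0" for x us using c[of x] by blast
  have c_fin: "finite {us. c x us \<noteq> 0}" for x using c[of x] by blast
  have c_sum: "x = (\<Sum>us\<in>{us. c x us \<noteq> 0}. smd (c x us) (tpd (map e us)))" for x
    by (rule c[of x, THEN conjunct2, THEN conjunct2])
  define v where "v = (\<lambda>(us, w). \<iota> (tpd (map e us)) * Hw d H w)"
  \<comment> \<open>The pairs of the PBW basis list the word of basis indices first, whereas the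
    double sum runs over \<open>w\<close> first; hence the \<open>prod.swap\<close> below.\<close>
  define C where "C = (\<lambda>(us, w). if w \<in> F then c (b w) us else 0)"
  have supp: "{p. C p \<noteq> 0} = prod.swap ` (SIGMA w:F. {us. c (b w) us \<noteq> 0})"
  proof (intro set_eqI)
    fix p show "p \<in> {p. C p \<noteq> 0} \<longleftrightarrow> p \<in> prod.swap ` (SIGMA w:F. {us. c (b w) us \<noteq> 0})"
      by (cases p) (auto simp: C_def image_iff)
  qed
  have fin: "finite {p. C p \<noteq> 0}" unfolding supp using F(1) c_fin by auto
  have "(\<Sum>p\<in>{p. C p \<noteq> 0}. smW (C p) (v p))
      = (\<Sum>(w, us)\<in>(SIGMA w:F. {us. c (b w) us \<noteq> 0}). smW (c (b w) us) (\<iota> (tpd (map e us)) * Hw d H w))"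
    unfolding supp by (subst sum.reindex) (auto intro!: sum.cong simp: C_def v_def)
  also have "\<dots> = (\<Sum>w\<in>F. \<Sum>us\<in>{us. c (b w) us \<noteq> 0}. smW (c (b w) us) (\<iota> (tpd (map e us)) * Hw d H w))"
    by (rule sum.Sigma[symmetric]) (use F(1) c_fin in auto)
  also have "\<dots> = (\<Sum>w\<in>F. \<iota> (b w) * Hw d H w)"
  proof (rule sum.cong[OF refl])
    fix w
    interpret h: module_hom smd smW \<iota>
      using \<iota>_hom Klin_iff_module_hom[OF md mW] by (simp add: Kalg_hom_def)
    have sc: "smW a (x * y) = smW a x * y" for a x y using algW unfolding Kalg_def by blast
    have "\<iota> (b w) = (\<Sum>us\<in>{us. c (b w) us \<noteq> 0}. smW (c (b w) us) (\<iota> (tpd (map e us))))"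
      by (subst c_sum[of "b w"]) (simp only: h.sum h.scale)
    then show "(\<Sum>us\<in>{us. c (b w) us \<noteq> 0}. smW (c (b w) us) (\<iota> (tpd (map e us)) * Hw d H w))
        = \<iota> (b w) * Hw d H w"
      by (simp add: sum_distrib_right sc)
  qed
  finally have s0: "(\<Sum>p\<in>{p. C p \<noteq> 0}. smW (C p) (v p)) = 0" using zero by simp
  let ?I = "{(us :: 'j list, w). length us = d \<and> w permutes {1..d}}"
  define rep where "rep c \<longleftrightarrow> (\<forall>p. p \<notin> ?I \<longrightarrow> c p = 0) \<and> finite {p. c p \<noteq> 0} \<and>
      0 = (\<Sum>p\<in>{p. c p \<noteq> 0}. smW (c p) (v p))" for c
  have "\<exists>!c. rep c"
    using spec[OF PBW[unfolded is_basis_on_def], of 0] unfolding rep_def v_def .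
  moreover have "rep C"
    unfolding rep_def
  proof (intro conjI allI impI)
    fix p :: "'j list \<times> (nat \<Rightarrow> nat)" assume "p \<notin> ?I"
    then show "C p = 0" using F(2) c_len by (cases p) (auto simp: C_def)
  qed (use s0 fin in simp_all)
  moreover have "rep (\<lambda>_. 0)" by (simp add: rep_def)
  ultimately have C0: "C = (\<lambda>_. 0)" by blast
  have "c (b w) us = 0" for us
    using w fun_cong[OF C0, of "(us, w)"] by (simp add: C_def)
  then show "b w = 0" by (subst c_sum[of "b w"]) simp
qed

lemma PBW_independent6:
  assumes dist: "distinct [w1, w2, w3, w4, w5, w6]"
    and perm: "\<And>w. w \<in> {w1, w2, w3, w4, w5, w6} \<Longrightarrow> w permutes {1..d}"
    and zero: "\<iota> b1 * Hw d H w1 + \<iota> b2 * Hw d H w2 + \<iota> b3 * Hw d H w3 + \<iota> b4 * Hw d H w4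
       + \<iota> b5 * Hw d H w5 + \<iota> b6 * Hw d H w6 = 0"
  shows "b1 = 0 \<and> b2 = 0 \<and> b3 = 0 \<and> b4 = 0 \<and> b5 = 0 \<and> b6 = 0"
proof -
  define b where "b w = (if w = w1 then b1 else if w = w2 then b2 else if w = w3 then b3
    else if w = w4 then b4 else if w = w5 then b5 else b6)" for w
  have v: "b w1 = b1" "b w2 = b2" "b w3 = b3" "b w4 = b4" "b w5 = b5" "b w6 = b6"
    using dist by (auto simp: b_def)
  have "(\<Sum>w\<in>{w1, w2, w3, w4, w5, w6}. \<iota> (b w) * Hw d H w) = 0"
    using zero dist by (simp add: v add.assoc)
  from PBW_independent[OF _ perm this] show ?thesis
    by (metis v finite.emptyI finite_insert insertCI)
qed

lemma H_independent:
  assumes i: "i \<in> {1..d-1}" and zero: "\<iota> a + \<iota> b * H i = 0"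
  shows "a = 0 \<and> b = 0"
proof -
  let ?s = "word_perm [i]"
  have neq: "?s \<noteq> id"
  proof
    assume "?s = id"
    then have "?s i = id i" by (rule fun_cong)
    then show False by simp
  qed
  have i': "i \<in> {1..<d}" using idx[OF i] by simp
  define c where "c w = (if w = id then a else b)" for w :: "nat \<Rightarrow> nat"
  have "(\<Sum>w\<in>{id, ?s}. \<iota> (c w) * Hw d H w) = 0"
    using zero neq Hw_simple[OF i', of H] by (simp add: c_def Hw_id del: word_perm.simps(2))
  moreover have "w permutes {1..d}" if "w \<in> {id, ?s}" for w
    using that word_perm_permutes[of "[i]" d] i' by (auto simp: permutes_id simp del: word_perm.simps(2))
  ultimately have "c w = 0" if "w \<in> {id, ?s}" for w
    using PBW_independent[of "{id, ?s}" c w] that by blast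
  from this[of id] this[of ?s] neq show ?thesis by (simp add: c_def del: word_perm.simps(2))
qed

lemma gen: "i \<in> {1..d-1} \<Longrightarrow> hecke_gen \<iota> (emb i S) (emb i R) (op \<sigma> i) (op \<rho> i) (H i)"
  by unfold_locales (use H_quad H_wreath H_independent in auto)

lemma H_independent6:
  assumes i: "1 \<le> i" "Suc i < d"
    and zero: "\<iota> a + \<iota> b * H i + \<iota> c * H (Suc i) + \<iota> x * (H i * H (Suc i)) + \<iota> y * (H (Suc i) * H i)
      + \<iota> z * (H i * H (Suc i) * H i) = 0"
  shows "a = 0 \<and> b = 0 \<and> c = 0 \<and> x = 0 \<and> y = 0 \<and> z = 0"
proof (rule PBW_independent6[OF word_perms_distinct[of i]])
  have i': "i \<in> {1..<d}" "Suc i \<in> {1..<d}" using i by auto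
  show "w permutes {1..d}" if "w \<in> {id, word_perm [i], word_perm [Suc i], word_perm [i, Suc i],
      word_perm [Suc i, i], word_perm [i, Suc i, i]}" for w
    using that i word_perm_permutes[of "[i]" d] word_perm_permutes[of "[Suc i]" d]
      word_perm_permutes[of "[i, Suc i]" d] word_perm_permutes[of "[Suc i, i]" d]
      word_perm_permutes[of "[i, Suc i, i]" d]
    by (auto simp: permutes_id simp del: word_perm.simps(2))
  show "\<iota> a * Hw d H id + \<iota> b * Hw d H (word_perm [i]) + \<iota> c * Hw d H (word_perm [Suc i])
    + \<iota> x * Hw d H (word_perm [i, Suc i]) + \<iota> y * Hw d H (word_perm [Suc i, i])
    + \<iota> z * Hw d H (word_perm [i, Suc i, i]) = 0"
    using zero by (simp only: Hw_id Hw_simple[OF i'(1)] Hw_simple[OF i'(2)] Hw_two[OF i' disjI1[OF refl]]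
        Hw_two[OF i'(2,1) disjI2[OF refl]] Hw_three[OF i' H_braid[OF i]] mult_1_right)
qed

lemma pair:
  assumes "1 \<le> i" "Suc i < d"
  shows "hecke_pair \<iota> (emb i S) (emb i R) (op \<sigma> i) (op \<rho> i) (H i)
    (emb (Suc i) S) (emb (Suc i) R) (op \<sigma> (Suc i)) (op \<rho> (Suc i)) (H (Suc i))"
proof -
  interpret one: hecke_gen \<iota> "emb i S" "emb i R" "op \<sigma> i" "op \<rho> i" "H i"
    by (rule gen) (use assms in auto)
  interpret two: hecke_gen \<iota> "emb (Suc i) S" "emb (Suc i) R" "op \<sigma> (Suc i)" "op \<rho> (Suc i)" "H (Suc i)"
    by (rule gen) (use assms in auto)
  show ?thesis
    by unfold_locales (use H_braid[OF assms] H_independent6[OF assms] in auto)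
qed

text \<open>\<open>universal\<close> asserts existence only; uniqueness comes from PBW, each basis
  element being a product of generators.\<close>

lemma alg_hom_eqI:
  assumes f: "Kalg_hom smW smW f" and g: "Kalg_hom smW smW g"
    and \<iota>: "\<And>b. f (\<iota> b) = g (\<iota> b)" and H: "\<And>i. i \<in> {1..d-1} \<Longrightarrow> f (H i) = g (H i)"
  shows "f x = g x"
proof (rule linear_eqI[OF mW mW PBW, where F = f and G = g])
  show "Klin smW smW f" "Klin smW smW g" using f g by (simp_all add: Kalg_hom_def)
  have mult: "f (x * y) = f x * f y" "g (x * y) = g x * g y" "f 1 = 1" "g 1 = 1" for x y
    using f g by (simp_all add: Kalg_hom_def)
  have Hprod: "f (Hprod H is) = g (Hprod H is)" if "set is \<subseteq> {1..<d}" for "is"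
    using that by (induction "is") (auto simp: mult H)
  fix p :: "'j list \<times> (nat \<Rightarrow> nat)" assume "p \<in> {(us, w). length us = d \<and> w permutes {1..d}}"
  then obtain us w where p: "p = (us, w)" "w permutes {1..d}" by auto
  obtain "is" where "set is \<subseteq> {1..<d}" "Hw d H w = Hprod H is"
    using Hw_word[OF p(2)] by blast
  then show "f (case p of (us, w) \<Rightarrow> \<iota> (tpd (map e us)) * Hw d H w)
      = g (case p of (us, w) \<Rightarrow> \<iota> (tpd (map e us)) * Hw d H w)"
    by (simp add: p mult \<iota> Hprod)
qed

text \<open>The generator \<open>H 1\<close> commutes with 1, so \<open>s_r_one\<close> applies, and
  \<open>emb_1_inj\<close> descends to the tensor square.\<close>

lemma \<sigma>_one: "\<sigma> 1 = 1" and \<rho>_one: "\<rho> 1 = 0"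
proof -
  have 1: "(1::nat) \<in> {1..d-1}" using d2 by simp
  interpret hecke_gen \<iota> "emb 1 S" "emb 1 R" "op \<sigma> 1" "op \<rho> 1" "H 1" by (rule gen[OF 1])
  have "emb 1 (\<sigma> 1) = emb 1 1"
    using s_r_one(1) op_emb[OF 1 sigma_lin, of 1] unfolding emb_one[OF 1] by simp
  then show "\<sigma> 1 = 1" by (rule emb_1_inj)
  have "emb 1 0 = 0" using emb_add[OF 1, of 0 0] by simp
  then have "emb 1 (\<rho> 1) = emb 1 0"
    using s_r_one(2) op_emb[OF 1 rho_lin, of 1] \<open>emb 1 0 = 0\<close> unfolding emb_one[OF 1] by simp
  then show "\<rho> 1 = 0" by (rule emb_1_inj)
qed

lemma H_emb_far:
  assumes "i \<in> {1..d-1}" "j \<in> {1..d-1}" "i + 2 \<le> j \<or> j + 2 \<le> i"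
  shows "H i * \<iota> (emb j Z) = \<iota> (emb j Z) * H i"
  using H_wreath[OF assms(1)] op_emb_far(1)[OF assms sigma_lin \<sigma>_one]
    op_emb_far(2)[OF assms rho_lin \<rho>_one] by (simp add: \<iota>_zero)

text \<open>Kept general in \<open>Z\<close> because the endomorphism uses \<open>S\<close> and its
  inverse uses \<open>h2i S\<close>.\<close>

lemma G_commute_far:
  assumes "i \<in> {1..d-1}" "j \<in> {1..d-1}" "i + 2 \<le> j \<or> j + 2 \<le> i"
  shows "(\<iota> (emb i Z) - H i) * (\<iota> (emb j Z) - H j) = (\<iota> (emb j Z) - H j) * (\<iota> (emb i Z) - H i)"
proof -
  have "j + 2 \<le> i \<or> i + 2 \<le> j" using assms(3) by blast
  note H_emb_far[OF assms] H_emb_far[OF assms(2,1) this] H_commute_far[OF assms]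
  moreover have "\<iota> (emb i Z) * \<iota> (emb j Z) = \<iota> (emb j Z) * \<iota> (emb i Z)"
    using emb_commute_far[OF assms, of Z Z] by (simp flip: \<iota>_mult)
  ultimately show ?thesis by (simp add: algebra_simps)
qed

end

section \<open>The endomorphism induced by \<open>hsh\<close>, and its inverse\<close>

locale qwreath_hash = qwreath smB e sm2 tp2 smd tpd d S R \<sigma> \<rho> smW \<iota> H
  for smB :: "'k::comm_ring_1 \<Rightarrow> 'b::ring_1 \<Rightarrow> 'b"
    and e :: "'j \<Rightarrow> 'b"
    and sm2 :: "'k \<Rightarrow> 'b2::ring_1 \<Rightarrow> 'b2" and tp2 :: "'b \<Rightarrow> 'b \<Rightarrow> 'b2"
    and smd :: "'k \<Rightarrow> 'bd::ring_1 \<Rightarrow> 'bd" and tpd :: "'b list \<Rightarrow> 'bd"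
    and d :: nat
    and S R :: 'b2 and \<sigma> \<rho> :: "'b2 \<Rightarrow> 'b2"
    and smW :: "'k \<Rightarrow> 'w::ring_1 \<Rightarrow> 'w" and \<iota> :: "'bd \<Rightarrow> 'w" and H :: "nat \<Rightarrow> 'w" +
  fixes hsh :: "'b \<Rightarrow> 'b"
  assumes hsh_hom: "Kalg_hom smB smB hsh" and hsh_bij: "bij hsh"
begin

abbreviation "hd1 \<equiv> hash hsh"
abbreviation "hdi \<equiv> hash (inv hsh)"
abbreviation "h2 \<equiv> hash' hsh"
abbreviation "h2i \<equiv> hash' (inv hsh)"

lemma inv_hsh_hom: "Kalg_hom smB smB (inv hsh)"
  using hsh_hom hsh_bij by (rule Kalg_hom_inv)

lemma hsh_inv: "hsh (inv hsh x) = x" "inv hsh (hsh x) = x"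
  using hsh_bij by (simp_all add: bij_is_surj surj_f_inv_f bij_is_inj)

lemma hd_inverse: "hd1 (hdi z) = z" "hdi (hd1 z) = z"
  using hashd_inverse hsh_hom inv_hsh_hom hsh_inv by blast+

lemma gen_hash:
  assumes "i \<in> {1..d-1}"
  shows "hecke_gen_hash (emb i S) (emb i R) (op \<sigma> i) (op \<rho> i) (H i) \<iota> hd1 hdi"
proof -
  interpret hecke_gen \<iota> "emb i S" "emb i R" "op \<sigma> i" "op \<rho> i" "H i" by (rule gen[OF assms])
  show ?thesis
    by unfold_locales
      (use hashd_alg_hom[OF hsh_hom] hd_inverse in \<open>simp_all add: Kalg_hom_def Klin_def\<close>)
qed

definition conds12 where
  "conds12 \<longleftrightarrow> \<sigma> R = h2 R \<and> \<sigma> S = h2 S \<and>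
     (\<forall>b. \<sigma> (h2 b) = h2 (\<sigma> b) \<and> S * h2 b - \<sigma> (h2 b) * S = \<rho> (h2 b) + h2 (\<rho> b))"

text \<open>Lifts the conditions from the tensor square to index \<open>i\<close>. On a pure tensor
  both sides are insertions with the same outer entries, transformed by \<open>hsh\<close>, so only
  the inner pair has to be compared.\<close>

lemma conds12_compat:
  assumes c: conds12 and i: "i \<in> {1..d-1}"
  shows "hecke_gen_hash_compat (emb i S) (emb i R) (op \<sigma> i) (op \<rho> i) (H i) \<iota> hd1 hdi"
proof -
  interpret hecke_gen_hash "emb i S" "emb i R" "op \<sigma> i" "op \<rho> i" "H i" \<iota> hd1 hdi
    by (rule gen_hash[OF i])
  note kl = hashd_Klin[OF hsh_hom] op_Klin[OF i sigma_lin] op_Klin[OF i rho_lin]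
  show ?thesis
  proof
    show "op \<sigma> i (emb i S) = hd1 (emb i S)" "op \<sigma> i (emb i R) = hd1 (emb i R)"
      using c by (simp_all add: op_emb[OF i sigma_lin] hashd_emb[OF hsh_hom i] conds12_def)
    fix b
    show "op \<sigma> i (hd1 b) = hd1 (op \<sigma> i b)"
    proof (rule Td_eqI_pair[OF md Klin_compose[OF kl(1,2)] Klin_compose[OF kl(2,1)] i])
      fix xs ys :: "'b list" and x y
      assume l: "length xs = i - 1" "length ys = d - i - 1"
      then have l': "length xs + length ys + 2 = d" using idx[OF i] by auto
      show "op \<sigma> i (hd1 (tpd (xs @ [x, y] @ ys))) = hd1 (op \<sigma> i (tpd (xs @ [x, y] @ ys)))"
        unfolding tpd_eq_ins[OF l']
        using c l l' by (simp add: op_ins[OF i sigma_lin] hashd_ins[OF hsh_hom] conds12_def)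
    qed
    show "emb i S * hd1 b - op \<sigma> i (hd1 b) * emb i S = op \<rho> i (hd1 b) + hd1 (op \<rho> i b)"
    proof (rule Td_eqI_pair[OF md
          Klin_diff[OF md Klin_mult_left[OF algd kl(1)] Klin_mult_right[OF algd Klin_compose[OF kl(1,2)]]]
          Klin_add[OF md Klin_compose[OF kl(1,3)] Klin_compose[OF kl(3,1)]] i])
      fix xs ys :: "'b list" and x y
      assume l: "length xs = i - 1" "length ys = d - i - 1"
      then have l': "length xs + length ys + 2 = d" using idx[OF i] by auto
      let ?z = "tp2 x y"
      let ?I = "inst (map hsh xs) (map hsh ys)"
      have k: "Klin sm2 smd ?I" by (rule ins_Klin) (use l' in simp)
      have diff: "?I (Z - Z') = ?I Z - ?I Z'" and add: "?I (Z + Z') = ?I Z + ?I Z'" for Z Z'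
        using Klin_iff_module_hom[OF m2 md] k module_hom.diff module_hom.add by metis+
      have "?I (S * h2 ?z - \<sigma> (h2 ?z) * S) = ?I (\<rho> (h2 ?z) + h2 (\<rho> ?z))"
        using c unfolding conds12_def by metis
      then show "emb i S * hd1 (tpd (xs @ [x, y] @ ys)) - op \<sigma> i (hd1 (tpd (xs @ [x, y] @ ys))) * emb i S
          = op \<rho> i (hd1 (tpd (xs @ [x, y] @ ys))) + hd1 (op \<rho> i (tpd (xs @ [x, y] @ ys)))"
        unfolding tpd_eq_ins[OF l'] diff add
        using l l' by (simp add: op_ins[OF i sigma_lin] op_ins[OF i rho_lin] hashd_ins[OF hsh_hom]
            emb_mult_ins[OF i])
    qed
  qed
qed

lemma conds12_pair:
  assumes c: conds12 and i: "1 \<le> i" "Suc i < d"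
  shows "hecke_pair_hash \<iota> (emb i S) (emb i R) (op \<sigma> i) (op \<rho> i) (H i)
    (emb (Suc i) S) (emb (Suc i) R) (op \<sigma> (Suc i)) (op \<rho> (Suc i)) (H (Suc i)) hd1 hdi"
proof -
  interpret hecke_pair \<iota> "emb i S" "emb i R" "op \<sigma> i" "op \<rho> i" "H i"
    "emb (Suc i) S" "emb (Suc i) R" "op \<sigma> (Suc i)" "op \<rho> (Suc i)" "H (Suc i)"
    by (rule pair[OF i])
  interpret one: hecke_gen_hash_compat "emb i S" "emb i R" "op \<sigma> i" "op \<rho> i" "H i" \<iota> hd1 hdi
    by (rule conds12_compat[OF c]) (use i in auto)
  interpret two: hecke_gen_hash_compat "emb (Suc i) S" "emb (Suc i) R" "op \<sigma> (Suc i)" "op \<rho> (Suc i)"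
    "H (Suc i)" \<iota> hd1 hdi
    by (rule conds12_compat[OF c]) (use i in auto)
  show ?thesis ..
qed

lemma conds12_cond3:
  assumes c: conds12 and "i \<in> {1..d-1}" "j \<in> {1..d-1}" "i = j + 1 \<or> j = i + 1"
  shows "emb i S * emb j S * emb i S + op \<sigma> i (emb j S) * emb i R
       = emb j S * emb i S * emb j S + op \<sigma> j (emb i S) * emb j R"
proof -
  have *: "emb k S * emb (Suc k) S * emb k S + op \<sigma> k (emb (Suc k) S) * emb k R
       = emb (Suc k) S * emb k S * emb (Suc k) S + op \<sigma> (Suc k) (emb k S) * emb (Suc k) R"
    if "1 \<le> k" "Suc k < d" for k
    using hecke_pair_hash.hash_cond3[OF conds12_pair[OF c that]] .
  from assms(4) show ?thesis
  proof
    assume "i = j + 1"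
    then show ?thesis using *[of j] assms(2,3) idx[OF assms(2)] by simp
  next
    assume "j = i + 1"
    then show ?thesis using *[of i] assms(2,3) idx[OF assms(3)] by simp
  qed
qed

lemma hash_conds_iff: "hash_conds sm2 tp2 smd tpd d S R \<sigma> \<rho> hsh \<longleftrightarrow> conds12"
proof
  assume "hash_conds sm2 tp2 smd tpd d S R \<sigma> \<rho> hsh"
  then show conds12 unfolding hash_conds_def conds12_def Let_def by blast
next
  assume c: conds12
  show "hash_conds sm2 tp2 smd tpd d S R \<sigma> \<rho> hsh"
    unfolding hash_conds_def Let_def
  proof (intro conjI)
    show "3 \<le> d \<longrightarrow> (\<forall>i\<in>{1..d-1}. \<forall>j\<in>{1..d-1}. i = j + 1 \<or> j = i + 1 \<longrightarrow>
       emb i S * emb j S * emb i S + op \<sigma> i (emb j S) * emb i R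
       = emb j S * emb i S * emb j S + op \<sigma> j (emb i S) * emb j R)"
      using conds12_cond3[OF c] by blast
  qed (use c in \<open>unfold conds12_def, blast+\<close>)
qed

text \<open>\<open>f\<close> maps the relations of \<open>H 1\<close> to the corresponding relations
  of its image, whose coefficient form is known; taking coefficients in the range of
  \<open>emb 1\<close> and cancelling \<open>emb 1\<close> leaves identities in the tensor
  square.\<close>

lemma induced_conds12:
  assumes "hash_induced sm2 tp2 smd tpd d S smW \<iota> H hsh f"
  shows conds12
proof -
  have 1: "(1::nat) \<in> {1..d-1}" using d2 by simp
  have f: "f (x + y) = f x + f y" "f (x * y) = f x * f y" "f (\<iota> b) = \<iota> (hd1 b)"
     "f (H 1) = \<iota> (emb 1 S) - H 1" for x y b
    using assms 1 unfolding hash_induced_def Kalg_hom_def Klin_def by auto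
  interpret hecke_gen_hash "emb 1 S" "emb 1 R" "op \<sigma> 1" "op \<rho> 1" "H 1" \<iota> hd1 hdi
    by (rule gen_hash[OF 1])
  have sS: "op \<sigma> 1 (emb 1 S) = hd1 (emb 1 S) \<and> op \<sigma> 1 (emb 1 R) = hd1 (emb 1 R)"
    using arg_cong[OF quad, of f] by (subst hash_quad_iff[symmetric]) (simp only: f)
  have sb: "op \<sigma> 1 (hd1 b) = hd1 (op \<sigma> 1 b) \<and>
      emb 1 S * hd1 b - op \<sigma> 1 (hd1 b) * emb 1 S = op \<rho> 1 (hd1 b) + hd1 (op \<rho> 1 b)" for b
    using arg_cong[OF wreath[of b], of f] by (subst hash_wreath_iff[symmetric]) (simp only: f)
  note e = op_emb[OF 1 sigma_lin] op_emb[OF 1 rho_lin] hashd_emb[OF hsh_hom 1]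
  show ?thesis
    unfolding conds12_def
  proof (intro conjI allI)
    show "\<sigma> R = h2 R" "\<sigma> S = h2 S" using sS unfolding e by (auto intro: emb_1_inj)
    fix b
    from sb[of "emb 1 b"] show "\<sigma> (h2 b) = h2 (\<sigma> b)"
      unfolding e by (auto intro: emb_1_inj)
    from sb[of "emb 1 b"] have "emb 1 (S * h2 b - \<sigma> (h2 b) * S) = emb 1 (\<rho> (h2 b) + h2 (\<rho> b))"
      unfolding e emb_add[OF 1] emb_diff[OF 1] emb_mult[OF 1] by (rule conjunct2)
    then show "S * h2 b - \<sigma> (h2 b) * S = \<rho> (h2 b) + h2 (\<rho> b)" by (rule emb_1_inj)
  qed
qed

lemma relationsI:
  assumes "\<And>i. 1 \<le> i \<Longrightarrow> Suc i < d \<Longrightarrow> h i * h (Suc i) * h i = h (Suc i) * h i * h (Suc i)"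
    and "\<And>i j. i \<in> {1..d-1} \<Longrightarrow> j \<in> {1..d-1} \<Longrightarrow> i + 2 \<le> j \<or> j + 2 \<le> i \<Longrightarrow> h i * h j = h j * h i"
    and "\<And>i. i \<in> {1..d-1} \<Longrightarrow> h i * h i = g (emb i S) * h i + g (emb i R)"
    and "\<And>i b. i \<in> {1..d-1} \<Longrightarrow> h i * g b = g (op \<sigma> i b) * h i + g (op \<rho> i b)"
  shows "relations g h"
  unfolding qw_relations_def
  using assms by (intro conjI allI ballI impI) auto

lemma \<iota>_hash_hom: "Kalg_hom smB smB k \<Longrightarrow> Kalg_hom smd smW (\<lambda>b. \<iota> (hash k b))"
  using \<iota>_hom hashd_alg_hom[of k] by (simp add: Kalg_hom_def Klin_def)

lemma conds12_induced_bij: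
  assumes c: conds12
  shows "\<exists>f. hash_induced sm2 tp2 smd tpd d S smW \<iota> H hsh f \<and> bij f"
proof -
  have "relations (\<lambda>b. \<iota> (hd1 b)) (\<lambda>i. \<iota> (emb i S) - H i)"
  proof (rule relationsI)
    fix i assume i: "1 \<le> i" "Suc i < d"
    show "(\<iota> (emb i S) - H i) * (\<iota> (emb (Suc i) S) - H (Suc i)) * (\<iota> (emb i S) - H i)
      = (\<iota> (emb (Suc i) S) - H (Suc i)) * (\<iota> (emb i S) - H i) * (\<iota> (emb (Suc i) S) - H (Suc i))"
      by (rule hecke_pair_hash.braid_hash[OF conds12_pair[OF c i]])
  next
    fix i assume i: "i \<in> {1..d-1}"
    interpret hecke_gen_hash_compat "emb i S" "emb i R" "op \<sigma> i" "op \<rho> i" "H i" \<iota> hd1 hdi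
      by (rule conds12_compat[OF c i])
    show "G * G = \<iota> (hd1 (emb i S)) * G + \<iota> (hd1 (emb i R))" by (rule hash_quad)
    show "G * \<iota> (hd1 b) = \<iota> (hd1 (op \<sigma> i b)) * G + \<iota> (hd1 (op \<rho> i b))" for b by (rule hash_wreath)
  qed (rule G_commute_far)
  from universal[OF conjI[OF \<iota>_hash_hom[OF hsh_hom] this]] obtain f where f: "Kalg_hom smW smW f"
    "\<And>b. f (\<iota> b) = \<iota> (hd1 b)" "\<And>i. i \<in> {1..d-1} \<Longrightarrow> f (H i) = \<iota> (emb i S) - H i" by blast
  have f_simps: "f (x + y) = f x + f y" "f (x * y) = f x * f y" for x y
    using f(1) by (simp_all add: Kalg_hom_def Klin_def)
  have p: "emb i (h2i S) = hdi (emb i S)" if "i \<in> {1..d-1}" for i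
    using hashd_emb[OF inv_hsh_hom that] by simp
  \<comment> \<open>This comes after \<open>f\<close> has been obtained, because the braid relation
    here is proved by applying \<open>f\<close>.\<close>
  have "relations (\<lambda>b. \<iota> (hdi b)) (\<lambda>i. \<iota> (emb i (h2i S)) - H i)"
  proof (rule relationsI)
    fix i assume i: "1 \<le> i" "Suc i < d"
    then have i': "i \<in> {1..d-1}" "Suc i \<in> {1..d-1}" by auto
    show "(\<iota> (emb i (h2i S)) - H i) * (\<iota> (emb (Suc i) (h2i S)) - H (Suc i)) * (\<iota> (emb i (h2i S)) - H i)
      = (\<iota> (emb (Suc i) (h2i S)) - H (Suc i)) * (\<iota> (emb i (h2i S)) - H i)
        * (\<iota> (emb (Suc i) (h2i S)) - H (Suc i))"
      unfolding p[OF i'(1)] p[OF i'(2)]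
      by (rule hecke_pair_hash.braid_hash_inv[OF conds12_pair[OF c i] _ f(3)[OF i'(1)] f(3)[OF i'(2)] f_simps])
        (simp add: fun_eq_iff f(2))
  next
    fix i assume i: "i \<in> {1..d-1}"
    interpret hecke_gen_hash_compat "emb i S" "emb i R" "op \<sigma> i" "op \<rho> i" "H i" \<iota> hd1 hdi
      by (rule conds12_compat[OF c i])
    show "(\<iota> (emb i (h2i S)) - H i) * (\<iota> (emb i (h2i S)) - H i)
       = \<iota> (hdi (emb i S)) * (\<iota> (emb i (h2i S)) - H i) + \<iota> (hdi (emb i R))"
      unfolding p[OF i] by (rule hash_inv_quad)
    show "(\<iota> (emb i (h2i S)) - H i) * \<iota> (hdi b)
       = \<iota> (hdi (op \<sigma> i b)) * (\<iota> (emb i (h2i S)) - H i) + \<iota> (hdi (op \<rho> i b))" for b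
      unfolding p[OF i] by (rule hash_inv_wreath)
  qed (rule G_commute_far)
  from universal[OF conjI[OF \<iota>_hash_hom[OF inv_hsh_hom] this]] obtain f' where f': "Kalg_hom smW smW f'"
    "\<And>b. f' (\<iota> b) = \<iota> (hdi b)" "\<And>i. i \<in> {1..d-1} \<Longrightarrow> f' (H i) = \<iota> (emb i (h2i S)) - H i" by blast
  have diff: "f (x - y) = f x - f y" "f' (x - y) = f' x - f' y" for x y
    using f(1) f'(1) Klin_iff_module_hom[OF mW mW] module_hom.diff unfolding Kalg_hom_def by metis+
  have comp: "Kalg_hom smW smW (\<lambda>x. f (f' x))" "Kalg_hom smW smW (\<lambda>x. f' (f x))"
      "Kalg_hom smW smW (\<lambda>x. x)"
    using f(1) f'(1) by (simp_all add: Kalg_hom_def Klin_def)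
  \<comment> \<open>On generators, \<open>H i\<close> goes to
    \<open>\<iota> (hd1 (hdi (emb i S)))\<close> minus the image
    \<open>\<iota> (emb i S) - H i\<close>, which is \<open>H i\<close> again.\<close>
  have "f (f' x) = x" for x
    by (rule alg_hom_eqI[OF comp(1,3)]) (simp_all add: f f' p hd_inverse diff)
  moreover have "f' (f x) = x" for x
    by (rule alg_hom_eqI[OF comp(2,3)]) (simp_all add: f f' p hd_inverse diff)
  ultimately have "bij f" by (metis bijI')
  moreover have "hash_induced sm2 tp2 smd tpd d S smW \<iota> H hsh f"
    unfolding hash_induced_def using f by simp
  ultimately show ?thesis by blast
qed

lemma hash_induced_iff_conds:
  "(\<exists>f. hash_induced sm2 tp2 smd tpd d S smW \<iota> H hsh f) \<longleftrightarrow> conds12"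
  using induced_conds12 conds12_induced_bij by blast


end

theorem theorem7p2:
  fixes smB :: "'k::comm_ring_1 \<Rightarrow> 'b::ring_1 \<Rightarrow> 'b"
    and e :: "'j \<Rightarrow> 'b"
    and sm2 :: "'k \<Rightarrow> 'b2::ring_1 \<Rightarrow> 'b2" and tp2 :: "'b \<Rightarrow> 'b \<Rightarrow> 'b2"
    and smd :: "'k \<Rightarrow> 'bd::ring_1 \<Rightarrow> 'bd" and tpd :: "'b list \<Rightarrow> 'bd"
    and d :: nat
    and S R :: 'b2 and \<sigma> \<rho> :: "'b2 \<Rightarrow> 'b2"
    and smW :: "'k \<Rightarrow> 'w::ring_1 \<Rightarrow> 'w" and \<iota> :: "'bd \<Rightarrow> 'w" and H :: "nat \<Rightarrow> 'w"
    and hsh :: "'b \<Rightarrow> 'b"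
  assumes d2: "d \<ge> 2"
    and B_alg: "Kalg smB"
    and B_free: "is_basis_on smB UNIV e"
    and T2: "is_tensor2 smB e sm2 tp2"
    and Td: "is_tensorpow smB e d smd tpd"
    and sigma_lin: "Klin sm2 sm2 \<sigma>" and rho_lin: "Klin sm2 sm2 \<rho>"
    and W: "is_qwreath smB e sm2 tp2 smd tpd d S R \<sigma> \<rho> smW \<iota> H"
    and hsh_aut: "Kalg_hom smB smB hsh" "bij hsh"
  shows "((\<exists>f. hash_induced sm2 tp2 smd tpd d S smW \<iota> H hsh f)
             \<longleftrightarrow> hash_conds sm2 tp2 smd tpd d S R \<sigma> \<rho> hsh) \<and>
         (hash_conds sm2 tp2 smd tpd d S R \<sigma> \<rho> hsh \<longrightarrow>
             (\<exists>f. hash_induced sm2 tp2 smd tpd d S smW \<iota> H hsh f \<and> bij f))"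
proof -
  interpret qwreath_hash smB e sm2 tp2 smd tpd d S R \<sigma> \<rho> smW \<iota> H hsh
    by unfold_locales (fact assms)+
  show ?thesis
    unfolding hash_conds_iff hash_induced_iff_conds using conds12_induced_bij by blast
qed

end
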